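(* Let $d\in\mathbb{N}$ and let $\mu$ be a Borel probability measure supported on a subset $E$ of $\mathbb{T}^{d}$. Let $\mathcal{A}=(A_n)_{n\in\mathbb{N}}$ be a sequence of expanding integral $d\times d$ matrices. Assume that there is a constant $K>1$ such that $\sigma(A_{n+1}A_n^{-1})\ge K$ for all $n\in\mathbb{N}$, and that there exists $s>d+1$ such that $$\widehat{\mu}(\mathbf{t})=O\big((\log|\mathbf{t}|_{\infty})^{-s}\big)\quad\text{as }|\mathbf{t}|_{\infty}\to\infty.$$ Let $\mathbf{y}\in[0,1)^d$ and let $r_1,\ldots,r_d:\mathbb{N}\to(0,\tfrac12)$ be functions. Then $$\mu\big(W_{\mathcal{A}}(\mathbf{y},(\mathcal{R}_n))\cap E\big)=\begin{cases}0&\text{if }\sum_{n=1}^{\infty}r_1(n)\cdots r_d(n)<\infty,\\ 1&\text{if }\sum_{n=1}^{\infty}r_1(n)\cdots r_d(n)=\infty.\end{cases}$$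
   Context: $\mathbb{T}^d=\mathbb{R}^d/\mathbb{Z}^d$, identified with $[0,1)^d$. For $\mathbf{t}\in\mathbb{R}^d$, $|\mathbf{t}|_\infty=\max_{1\le i\le d}|t_i|$, and $\widehat{\mu}(\mathbf{t})=\int e^{-2\pi i\langle \mathbf{t},\mathbf{x}\rangle}\,d\mu(\mathbf{x})$ (with $\mu$ viewed as a measure on $[0,1)^d$), where $\langle\mathbf{t},\mathbf{x}\rangle=t_1x_1+\cdots+t_dx_d$. "$\mu$ supported on $E$" means $\mathrm{supp}(\mu)\subset E$; $E$ is a measurable set. For a real $d\times d$ matrix $A$, $\sigma(A)=\inf\{\|A\mathbf{x}\|_2:\|\mathbf{x}\|_2=1\}$ denotes its smallest singular value. An expanding integral matrix is a $d\times d$ matrix with integer entries all of whose (complex) eigenvalues have modulus $>1$. For $\alpha\in\mathbb{R}$, $\|\alpha\|=\min\{|\alpha-m|:m\in\mathbb{Z}\}$. For $n\in\mathbb{N}$, $\mathcal{R}_n=\{\mathbf{x}\in[0,1)^d:\|x_i\|\le r_i(n),\ 1\le i\le d\}$, and $$W_{\mathcal{A}}(\mathbf{y},(\mathcal{R}_n))=\{\mathbf{x}\in\mathbb{T}^d: A_n\mathbf{x}\in\mathbf{y}+\mathcal{R}_n\ (\mathrm{mod}\ 1)\text{ for infinitely many }n\in\mathbb{N}\}.$$ *)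

theory Defs
  imports "HOL-Analysis.Analysis" "HOL-Probability.Probability" "HOL-Library.Landau_Symbols"
begin

section \<open>The torus\<close>

text \<open>
  The torus T = R^d / Z^d is identified with its fundamental domain [0,1)^d, where
  d is the cardinality of the finite index type. The reduction map \<open>mod_one\<close> plays the role of the
  quotient map, and \<open>torus\<close> carries the quotient topology (not the subspace topology of the cube).
\<close>

definition unit_cube :: "(real ^ 'n) set" where
  "unit_cube = {x. \<forall>i. 0 \<le> x $ i \<and> x $ i < 1}"

definition mod_one :: "real ^ 'n \<Rightarrow> real ^ 'n" where
  "mod_one x = (\<chi> i. frac (x $ i))"

definition torus :: "(real ^ 'n) topology" where
  "torus = topology (\<lambda>U. U \<subseteq> unit_cube \<and> open (mod_one -` U))"

definition torus_borel :: "(real ^ 'n) measure" where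
  "torus_borel = sigma (topspace torus) {U. openin torus U}"

definition measure_support :: "'a topology \<Rightarrow> 'a measure \<Rightarrow> 'a set" where
  "measure_support T M = {x \<in> topspace T. \<forall>U. openin T U \<and> x \<in> U \<longrightarrow> emeasure M U > 0}"

lemma mod_one_in_unit_cube: "mod_one x \<in> unit_cube"
  by (simp add: mod_one_def unit_cube_def frac_lt_1)

lemma mod_one_id: "x \<in> unit_cube \<Longrightarrow> mod_one x = x"
  by (simp add: mod_one_def unit_cube_def vec_eq_iff frac_eq)

lemma openin_torus: "openin torus U \<longleftrightarrow> U \<subseteq> unit_cube \<and> open (mod_one -` U)"
proof -
  have "istopology (\<lambda>U :: (real ^ 'n) set. U \<subseteq> unit_cube \<and> open (mod_one -` U))"
    unfolding istopology_def by (auto simp: vimage_Union intro!: open_Int open_UN)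
  then show ?thesis
    unfolding torus_def by (subst topology_inverse') auto
qed

lemma topspace_torus: "topspace torus = (unit_cube :: (real ^ 'n) set)"
proof -
  have "mod_one -` unit_cube = (UNIV :: (real ^ 'n) set)"
    using mod_one_in_unit_cube by auto
  then have "openin torus (unit_cube :: (real ^ 'n) set)"
    by (simp add: openin_torus)
  then show ?thesis
    by (meson openin_subset openin_torus openin_topspace subset_antisym)
qed

lemma quotient_map_mod_one: "quotient_map euclidean torus mod_one"
proof -
  have "range mod_one = (unit_cube :: (real ^ 'n) set)"
    using mod_one_in_unit_cube mod_one_id by (metis image_subset_iff rangeI subsetI subset_antisym)
  then show ?thesis
    by (simp add: quotient_map_def topspace_torus openin_torus vimage_def)
qed

lemma space_torus_borel: "space torus_borel = unit_cube"
  by (simp add: torus_borel_def topspace_torus space_measure_of_conv)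

lemma openin_torus_halfspace:
  assumes "0 \<le> a"
  shows "openin torus {x :: real ^ 'n. x \<in> unit_cube \<and> a < x $ i}"
proof -
  have 1: "open {t :: real. a < frac t}"
  proof -
    have "{t :: real. a < frac t} = (\<Union>k::int. {of_int k + a<..<of_int k + 1})" (is "?L = ?R")
    proof (intro equalityI subsetI)
      fix t assume "t \<in> ?L"
      then have "t \<in> {of_int \<lfloor>t\<rfloor> + a<..<of_int \<lfloor>t\<rfloor> + 1}"
        by (auto simp: frac_def) 
      then show "t \<in> ?R" by blast
    next
      fix t assume "t \<in> ?R"
      then obtain k :: int where k: "of_int k + a < t" "t < of_int k + 1" by auto
      then have "\<lfloor>t\<rfloor> = k" using assms by (intro floor_unique) auto
      then show "t \<in> ?L" using k by (simp add: frac_def)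
    qed
    then show ?thesis by (auto intro: open_UN)
  qed
  have "mod_one -` {x :: real ^ 'n. x \<in> unit_cube \<and> a < x $ i} = (\<lambda>x. x $ i) -` {t. a < frac t}"
    using mod_one_in_unit_cube by (auto simp: mod_one_def)
  then show ?thesis
    using open_vimage[OF 1, of "\<lambda>x :: real ^ 'n. x $ i"]
    by (auto simp: openin_torus continuous_on_component)
qed

lemma sets_torus_borel: "sets torus_borel = sets (restrict_space borel (unit_cube :: (real ^ 'n) set))"
proof
  have sub: "U \<in> sets (restrict_space borel unit_cube)" if "openin torus U" for U :: "(real ^ 'n) set"
  proof -
    have "U = unit_cube \<inter> (mod_one -` U)"
      using that by (auto simp: openin_torus mod_one_id)
    moreover have "mod_one -` U \<in> sets borel"
      using that by (auto simp: openin_torus)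
    ultimately show ?thesis
      by (metis (no_types, lifting) image_eqI sets_restrict_space)
  qed
  have "sigma_sets unit_cube {U. openin torus U} \<subseteq> sets (restrict_space borel (unit_cube :: (real ^ 'n) set))"
    using sub sets.sigma_sets_subset[of "{U. openin torus U}" "restrict_space borel unit_cube"]
    by (auto simp: space_restrict_space)
  moreover have "sets (torus_borel :: (real ^ 'n) measure) = sigma_sets unit_cube {U. openin torus U}"
    unfolding torus_borel_def topspace_torus
    by (rule sets_measure_of) (auto simp: openin_torus)
  ultimately show "sets torus_borel \<subseteq> sets (restrict_space borel (unit_cube :: (real ^ 'n) set))"
    by simp
next
  have op: "U \<in> sets torus_borel" if "openin torus U" for U :: "(real ^ 'n) set"
    unfolding torus_borel_def using that openin_subset
    by (auto simp: sets_measure_of_conv intro!: sigma_sets.Basic)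
  have coord: "(\<lambda>x. x $ i) \<in> borel_measurable (torus_borel :: (real ^ 'n) measure)" for i
    unfolding borel_measurable_iff_greater
  proof
    fix a :: real
    show "{w \<in> space torus_borel. a < w $ i} \<in> sets torus_borel"
    proof (cases "0 \<le> a")
      case True
      then show ?thesis
        using op[OF openin_torus_halfspace[of a i]] by (simp add: space_torus_borel)
    next
      case False
      then have "{w \<in> space torus_borel. a < w $ i} = space torus_borel"
        by (auto simp: space_torus_borel unit_cube_def not_le intro: less_le_trans)
      then show ?thesis by simp
    qed
  qed
  have id: "(\<lambda>x. x) \<in> borel_measurable (torus_borel :: (real ^ 'n) measure)"
    unfolding borel_measurable_euclidean_space[of "\<lambda>x. x"]
    using coord by (auto simp: Basis_vec_def inner_axis)
  show "sets (restrict_space borel (unit_cube :: (real ^ 'n) set)) \<subseteq> sets torus_borel"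
  proof
    fix X :: "(real ^ 'n) set" assume "X \<in> sets (restrict_space borel unit_cube)"
    then obtain B where B: "B \<in> sets borel" "X = unit_cube \<inter> B"
      by (auto simp: sets_restrict_space)
    have "(\<lambda>x. x) -` B \<inter> space torus_borel \<in> sets torus_borel"
      using id B(1) by (rule measurable_sets)
    then show "X \<in> sets torus_borel"
      using B(2) by (simp add: space_torus_borel Int_commute vimage_def)
  qed
qed

definition fourier_coeff :: "(real ^ 'n) measure \<Rightarrow> real ^ 'n \<Rightarrow> complex" where
  "fourier_coeff \<mu> t = (\<integral>x. exp (- 2 * complex_of_real pi * \<i> * complex_of_real (t \<bullet> x)) \<partial>\<mu>)"


section \<open>Matrices\<close>

definition smallest_singular_value :: "real ^ 'n ^ 'n \<Rightarrow> real" where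
  "smallest_singular_value A = Inf {norm (A *v x) | x. norm x = 1}"

definition complex_eigenvalue :: "real ^ 'n ^ 'n \<Rightarrow> complex \<Rightarrow> bool" where
  "complex_eigenvalue A z \<longleftrightarrow>
     (\<exists>v :: complex ^ 'n. v \<noteq> 0 \<and> map_matrix complex_of_real A *v v = z *s v)"

definition expanding_integral_matrix :: "real ^ 'n ^ 'n \<Rightarrow> bool" where
  "expanding_integral_matrix A \<longleftrightarrow>
     (\<forall>i j. A $ i $ j \<in> \<int>) \<and> (\<forall>z. complex_eigenvalue A z \<longrightarrow> norm z > 1)"


section \<open>The shrinking target set\<close>

definition dist_int :: "real \<Rightarrow> real" where
  "dist_int a = (INF m::int. \<bar>a - of_int m\<bar>)"

text \<open>The infimum is a minimum.\<close>

lemma dist_int_eq_round: "dist_int a = \<bar>a - of_int (round a)\<bar>"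
  unfolding dist_int_def
  by (rule cInf_eq_minimum) (use round_diff_minimal in auto)

definition target_box :: "('n \<Rightarrow> nat \<Rightarrow> real) \<Rightarrow> nat \<Rightarrow> (real ^ 'n) set" where
  "target_box r n = {x \<in> unit_cube. \<forall>i. dist_int (x $ i) \<le> r i n}"

text \<open>Here and in all sequences below the index runs over the positive integers.\<close>

definition shrinking_target_set ::
  "(nat \<Rightarrow> real ^ 'n ^ 'n) \<Rightarrow> real ^ 'n \<Rightarrow> (nat \<Rightarrow> (real ^ 'n) set) \<Rightarrow> (real ^ 'n) set" where
  "shrinking_target_set A y R =
     {x \<in> unit_cube. infinite {n. n \<ge> 1 \<and> mod_one (A n *v x) \<in> mod_one ` ((\<lambda>z. y + z) ` R n)}}"

end

theory Submission
  imports Defs "HOL-Real_Asymp.Real_Asymp"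
begin

text \<open>
  For a hit of the target at time n the point A_n x - y has to lie within r_i(n) of the integers
  in every coordinate. Each box is compared with a product of triangle functions, because the
  Fourier coefficients of a triangle are nonnegative and sum to its value 1 at the origin. Majorants and
  minorants of this kind cost no logarithms: the absolute sum of their coefficients
  stays bounded however small the box is. Composing with A_n moves the frequency k to the frequency
  A_n^T k, whose length is at least a constant times K^n |k| (\<open>transpose_growth\<close>), so the decay of
  the Fourier transform makes every nonzero frequency contribute a factor of size n^(-s).

  If the volumes p_n = r_1(n) ... r_d(n) are summable, a triangle majorant gives
  \<mu>(hit at time n) \<le> const (p_n + n^(-s)) (\<open>measure_box_hit_le\<close>), and the first Borel--Cantelli
  lemma applies.

  If they are not summable, let f_n be the triangle function supported in the box and S_N the sum
  of f_n(A_n x - y) over the n \<le> N with p_n \<ge> n^(-2); the other indices contribute a convergent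
  series. Let \<Phi>_N be the sum of p_n over the same n. The heart of the proof is the
  variance bound, integral of (S_N - \<Phi>_N)^2 \<le> const (\<Phi>_N + 1) (\<open>variance_le\<close>). By Chebyshev's
  inequality S_N is then unbounded almost everywhere, and an unbounded S_N forces infinitely many
  hits.

  Expanding the square gives, for m \<le> n and nonzero frequencies k and l, the coefficient of \<mu> at
  A_m^T k - A_n^T l = A_m^T z with z = k - B^T l and B = A_n A_m^(-1), where B^T expands by
  D = K^(n-m). There are three kinds of pairs (\<open>pair_correlation\<close>).

  If |z| \<ge> 1/2 and |k| \<le> D/2, then |z| \<ge> D/2, and the coefficient is O(n^(-s)). There are
  at most n such m for each n, and n^(1-s) is summable because s > 2.

  If |z| \<ge> 1/2 and |k| > D/2, the coefficient is O(m^(-s)), and the tail of the triangle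
  coefficients supplies a small power of 1/D at the cost of m^(1/2), by the bound p_m \<ge> m^(-2).

  If |z| < 1/2, nothing is known about the coefficient, and such pairs have to be counted
  (\<open>near_coincidence_sum\<close>). The frequencies k that occur are essentially D-separated and stay away
  from the origin at distance about D, so the sum of the triangle coefficients over them behaves
  like an integral over the complement of a cube divided by its volume: it is O(1/D), whatever the
  shape of the box. Since the coefficient at l is at most p_n, these pairs contribute
  O((p_m + p_n) / D), whose sum over m \<le> n \<le> N is O(\<Phi>_N).
\<close>

section \<open>The Fourier series of the triangle function\<close>

text \<open>
  The chord from 1 to cis t has length 2 sin (t/2) and direction (t - pi)/2; this closed form is the
  limit on the unit circle of the sine series below.
\<close>
lemma Ln_one_minus_cis:
  assumes "0 < t" "t < 2 * pi"
  shows "Im (Ln (1 - cis t)) = (t - pi) / 2"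
proof -
  have s: "sin (t/2) > 0" using assms by (intro sin_gt_zero) auto
  have *: "1 - cis t = of_real (2 * sin (t/2)) * cis ((t - pi)/2)"
  proof -
    have c: "cos ((t - pi)/2) = sin (t/2)" "sin ((t-pi)/2) = - cos (t/2)"
      by (simp_all add: diff_divide_distrib cos_diff sin_diff)
    have t: "cos t = 1 - 2 * (sin (t/2))\<^sup>2" "sin t = 2 * sin (t/2) * cos (t/2)"
      using cos_double_sin[of "t/2"] sin_double[of "t/2"] by simp_all
    show ?thesis
      by (rule complex_eqI) (simp_all add: c t power2_eq_square)
  qed
  have "Arg (1 - cis t) = (t - pi)/2"
    by (rule Arg_unique'[of "2 * sin (t/2)"])
       (use s assms * in \<open>auto simp: rcis_def\<close>)
  moreover have "1 - cis t \<noteq> 0" using s * by auto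
  ultimately show ?thesis by (simp add: Arg_eq_Im_Ln)
qed

text \<open>
  The series of sin (k t) / k converges too slowly to be handled directly; damped by powers of \<rho>
  it is the imaginary part of a logarithm.
\<close>
lemma Abel_sum_sin:
  assumes "0 \<le> \<rho>" "\<rho> < 1"
  shows "(\<lambda>k. - (\<rho>^k * sin (real k * t) / real k)) sums Im (Ln (1 - of_real \<rho> * cis t))"
proof -
  have "(\<lambda>n. - ((- (- (of_real \<rho> * cis t)))^n) / of_nat n) sums ln (1 + (- (of_real \<rho> * cis t)))"
    by (rule Ln_series') (use assms in \<open>simp add: norm_mult\<close>)
  then have "(\<lambda>n. Im (- ((of_real \<rho> * cis t)^n) / of_nat n)) sums Im (Ln (1 - of_real \<rho> * cis t))"
    by (intro sums_Im) simp
  moreover have "(\<lambda>n. Im (- ((of_real \<rho> * cis t)^n) / of_nat n)) = (\<lambda>n. - (\<rho>^n * sin (real n * t) / real n))"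
    by (intro ext) (simp add: power_mult_distrib Complex.DeMoivre flip: of_real_power)
  ultimately show ?thesis by (simp only:)
qed

lemma Abel_cos_deriv:
  assumes "0 \<le> \<rho>" "\<rho> < 1"
  shows "((\<lambda>t. \<Sum>k. \<rho>^k * cos (real k * t) / (real k)\<^sup>2) has_real_derivative
           Im (Ln (1 - of_real \<rho> * cis t))) (at t)"
proof -
  have "((\<lambda>t. \<Sum>k. \<rho>^k * cos (real k * t) / (real k)\<^sup>2) has_real_derivative
           (\<Sum>k. - (\<rho>^k * sin (real k * t) / real k))) (at t)"
  proof (rule has_field_derivative_series'(2)[where S = UNIV and ?x0.0 = 0])
    show "((\<lambda>t. \<rho>^n * cos (real n * t) / (real n)\<^sup>2) has_real_derivative
        - (\<rho>^n * sin (real n * t) / real n)) (at t)" for n t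
      by (cases "n = 0") (auto intro!: derivative_eq_intros simp: field_simps power2_eq_square)
    show "uniformly_convergent_on UNIV (\<lambda>n t. \<Sum>i<n. - (\<rho>^i * sin (real i * t) / real i))"
    proof (rule Weierstrass_m_test')
      fix n :: nat and t :: real
      have "\<bar>sin (real n * t)\<bar> / real n \<le> 1"
        by (cases "n = 0") (auto simp: divide_le_eq intro: order_trans[OF abs_sin_le_one])
      then have "\<rho>^n * (\<bar>sin (real n * t)\<bar> / real n) \<le> \<rho>^n * 1"
        by (rule mult_left_mono) (use assms in auto)
      then show "norm (- (\<rho>^n * sin (real n * t) / real n)) \<le> \<rho>^n"
        using assms by (simp add: abs_mult)
    qed (use assms in \<open>simp add: summable_geometric\<close>)
    have "summable (\<lambda>n. \<rho>^n / (real n)\<^sup>2)"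
    proof (rule summable_comparison_test')
      show "summable (\<lambda>n. \<rho>^n)" using assms by (simp add: summable_geometric)
      show "norm (\<rho>^n / (real n)\<^sup>2) \<le> \<rho>^n" for n
      proof (cases "n = 0")
        case False
        then have "\<rho>^n / (real n)\<^sup>2 \<le> \<rho>^n / 1"
          using assms by (intro divide_left_mono) auto
        then show ?thesis using assms by simp
      qed (use assms in auto)
    qed
    then show "summable (\<lambda>n. \<rho>^n * cos (real n * 0) / (real n)\<^sup>2)" by simp
  qed auto
  then show ?thesis using Abel_sum_sin[OF assms, of t] by (simp add: sums_iff)
qed

lemma cos_series_summable: "summable (\<lambda>k. cos (real k * t) / (real k)\<^sup>2)"
proof (rule summable_comparison_test')
  show "summable (\<lambda>k. 1 / (real k)\<^sup>2)" using inverse_power_summable[of 2, where 'a = real] by (simp add: field_simps)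
  show "norm (cos (real n * t) / (real n)\<^sup>2) \<le> 1 / (real n)\<^sup>2" for n
    by (simp add: divide_right_mono)
qed

text \<open>
  The damped series has derivative Im (Ln (1 - \<rho> cis t)), which is bounded by pi and tends to
  (t - pi)/2 as \<rho> tends to 1. Integrating over [0,t] with dominated convergence gives a quadratic
  polynomial. The constant is kept as a series: it cancels in the second difference that produces
  the triangle.
\<close>
lemma cos_series_quadratic:
  assumes "0 \<le> t" "t \<le> 2 * pi"
  shows "(\<Sum>k. cos (real k * t) / (real k)\<^sup>2) = (\<Sum>k. 1 / (real k)\<^sup>2) + t\<^sup>2 / 4 - pi * t / 2"
proof -
  define \<rho> where "\<rho> n = 1 - 1 / real (n + 2)" for n
  have \<rho>: "0 \<le> \<rho> n" "\<rho> n < 1" for n by (auto simp: \<rho>_def)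
  have \<rho>1: "\<rho> \<longlonglongrightarrow> 1" unfolding \<rho>_def by real_asymp
  define G where "G n t = (\<Sum>k. \<rho> n^k * cos (real k * t) / (real k)\<^sup>2)" for n t
  have lim: "(\<lambda>n. G n u) \<longlonglongrightarrow> (\<Sum>k. cos (real k * u) / (real k)\<^sup>2)" for u
    unfolding G_def
  proof (rule tannerys_theorem[where M = "\<lambda>k. 1 / (real k)\<^sup>2" and F = sequentially, THEN conjunct2, THEN conjunct2])
    show "(\<lambda>n. \<rho> n^k * cos (real k * u) / (real k)\<^sup>2) \<longlonglongrightarrow> cos (real k * u) / (real k)\<^sup>2" for k
      using tendsto_mult[OF tendsto_power[OF \<rho>1, of k] tendsto_const[of "cos (real k * u) / (real k)\<^sup>2"]] by simp
    have "norm (\<rho> n^k * cos (real k * u) / (real k)\<^sup>2) \<le> 1 / (real k)\<^sup>2" for k n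
    proof -
      have "\<rho> n ^ k * \<bar>cos (real k * u)\<bar> \<le> 1 * 1"
        by (rule mult_mono) (use \<rho>[of n] in \<open>auto intro: power_le_one\<close>)
      then show ?thesis using \<rho>[of n] by (simp add: abs_mult divide_right_mono)
    qed
    then show "\<forall>\<^sub>F (k, n) in sequentially \<times>\<^sub>F sequentially. norm (\<rho> n^k * cos (real k * u) / (real k)\<^sup>2) \<le> 1 / (real k)\<^sup>2"
      by (intro always_eventually) auto
    show "summable (\<lambda>k. 1 / (real k)\<^sup>2)" using cos_series_summable[of 0] by simp
  qed auto
  \<comment> \<open>At the end points the damped derivatives vanish, so their limit differs there from the linear function.\<close>
  define h where "h u = (if u = 0 \<or> u = 2*pi then 0 else (u - pi) / 2)" for u
  have int: "((\<lambda>u. Im (Ln (1 - of_real (\<rho> n) * cis u))) has_integral (G n t - G n 0)) {0..t}" for n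
    by (rule fundamental_theorem_of_calculus)
       (use assms Abel_cos_deriv[OF \<rho>] in \<open>auto simp: G_def has_real_derivative_iff_has_vector_derivative[symmetric] intro: has_field_derivative_at_within\<close>)
  have "(\<lambda>n. integral {0..t} (\<lambda>u. Im (Ln (1 - of_real (\<rho> n) * cis u)))) \<longlonglongrightarrow> integral {0..t} h"
  proof (rule dominated_convergence(2)[where h = "\<lambda>_. pi"])
    show "(\<lambda>u. Im (Ln (1 - of_real (\<rho> n) * cis u))) integrable_on {0..t}" for n
      using int by blast
    show "norm (Im (Ln (1 - of_real (\<rho> n) * cis u))) \<le> pi" for n u
    proof -
      have "Re (1 - of_real (\<rho> n) * cis u) > 0"
      proof -
        have "\<rho> n * cos u \<le> \<rho> n * 1" by (rule mult_left_mono) (use \<rho> in auto)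
        then show ?thesis using \<rho>[of n] by simp
      qed
      then have "1 - of_real (\<rho> n) * cis u \<noteq> 0" by (auto simp only: zero_complex.sel)
      from mpi_less_Im_Ln[OF this] Im_Ln_le_pi[OF this] show ?thesis by auto
    qed
    fix u assume u: "u \<in> {0..t}"
    show "(\<lambda>n. Im (Ln (1 - of_real (\<rho> n) * cis u))) \<longlonglongrightarrow> h u"
    proof (cases "u = 0 \<or> u = 2 * pi")
      case True
      then have "cis u = 1" by (auto simp: cis.ctr complex_eq_iff)
      then have "Im (Ln (1 - of_real (\<rho> n) * cis u)) = 0" for n
        using \<rho>[of n] Ln_of_real[of "1 - \<rho> n"] by simp
      with True show ?thesis by (simp add: h_def)
    next
      case False
      then have u: "0 < u" "u < 2*pi" using u assms by auto
      have "cos u \<noteq> 1"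
      proof
        assume "cos u = 1"
        then have "sin (u/2) = 0" using cos_double_sin[of "u/2"] by simp
        moreover have "sin (u/2) > 0" using u by (intro sin_gt_zero) auto
        ultimately show False by simp
      qed
      then have "Re (1 - cis u) > 0" using cos_le_one[of u] by (simp add: less_le)
      then have "1 - cis u \<notin> \<real>\<^sub>\<le>\<^sub>0" by (auto simp: complex_nonpos_Reals_iff)
      then have "(\<lambda>n. Im (Ln (1 - of_real (\<rho> n) * cis u))) \<longlonglongrightarrow> Im (Ln (1 - of_real 1 * cis u))"
        by (intro tendsto_intros \<rho>1) auto
      then show ?thesis using Ln_one_minus_cis[OF u] False by (simp add: h_def)
    qed
  qed auto
  moreover have "integral {0..t} (\<lambda>u. Im (Ln (1 - of_real (\<rho> n) * cis u))) = G n t - G n 0" for n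
    using int by (rule integral_unique)
  moreover have "integral {0..t} h = t\<^sup>2/4 - pi * t / 2"
  proof -
    have d: "((\<lambda>u. u\<^sup>2/4 - pi * u / 2) has_vector_derivative (u - pi) / 2) (at u within {0..t})" for u :: real
      unfolding has_real_derivative_iff_has_vector_derivative[symmetric]
      by (rule derivative_eq_intros refl | simp add: diff_divide_distrib)+
    have "((\<lambda>u. (u - pi) / 2) has_integral (t\<^sup>2/4 - pi * t / 2 - (0\<^sup>2/4 - pi * 0 / 2))) {0..t}"
      by (rule fundamental_theorem_of_calculus[OF assms(1) d])
    then have "((\<lambda>u. (u - pi) / 2) has_integral (t\<^sup>2/4 - pi * t / 2)) {0..t}" by simp
    then have "(h has_integral (t\<^sup>2/4 - pi * t / 2)) {0..t}"
      by (rule has_integral_spike_finite[where S = "{0, 2*pi}", rotated 2]) (auto simp: h_def)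
    then show ?thesis by (rule integral_unique)
  qed
  ultimately have "(\<lambda>n. G n t - G n 0) \<longlonglongrightarrow> t\<^sup>2/4 - pi * t / 2" by simp
  moreover have "(\<lambda>n. G n t - G n 0) \<longlonglongrightarrow> (\<Sum>k. cos (real k * t) / (real k)\<^sup>2) - (\<Sum>k. cos (real k * 0) / (real k)\<^sup>2)"
    by (intro tendsto_diff lim)
  ultimately show ?thesis using LIMSEQ_unique by force
qed

definition triangle :: "real \<Rightarrow> real \<Rightarrow> real" where
  "triangle r x = max 0 (1 - dist_int x / r)"

definition triangle_coeff :: "real \<Rightarrow> int \<Rightarrow> real" where
  "triangle_coeff r k = (if k = 0 then r else (sin (pi * r * of_int k))\<^sup>2 / (pi\<^sup>2 * (of_int k)\<^sup>2 * r))"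

lemma sum_symmetric_int_interval:
  fixes f :: "int \<Rightarrow> 'a::comm_monoid_add"
  shows "(\<Sum>k\<in>{-int M..int M}. f k) = f 0 + (\<Sum>k=1..M. f (int k) + f (- int k))"
proof (induction M)
  case (Suc M)
  have "{-int (Suc M)..int (Suc M)} = insert (int (Suc M)) (insert (- int (Suc M)) {-int M..int M})" by auto
  then have "(\<Sum>k\<in>{-int (Suc M)..int (Suc M)}. f k) = f (int (Suc M)) + (f (- int (Suc M)) + (\<Sum>k\<in>{-int M..int M}. f k))"
    by simp
  then show ?case using Suc by (simp add: ac_simps)
qed simp

lemma cos_series_abs_le_one:
  assumes "\<bar>v\<bar> \<le> 1"
  shows "(\<Sum>k. cos (real k * (2 * pi * v)) / (real k)\<^sup>2) = (\<Sum>k. 1 / (real k)\<^sup>2) + pi\<^sup>2 * (v\<^sup>2 - \<bar>v\<bar>)"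
proof -
  have "(\<Sum>k. cos (real k * (2 * pi * v)) / (real k)\<^sup>2) = (\<Sum>k. cos (real k * (2 * pi * \<bar>v\<bar>)) / (real k)\<^sup>2)"
    by (cases "v \<ge> 0") simp_all
  also have "\<dots> = (\<Sum>k. 1 / (real k)\<^sup>2) + (2 * pi * \<bar>v\<bar>)\<^sup>2 / 4 - pi * (2 * pi * \<bar>v\<bar>) / 2"
    by (rule cos_series_quadratic) (use assms in auto)
  finally show ?thesis by (simp add: power2_eq_square algebra_simps)
qed

text \<open>
  A second difference of the periodic quadratic of \<open>cos_series_quadratic\<close> is constant away from the
  kink at the integers and linear near it, hence a triangle. The factor sin^2 in the coefficients
  comes from taking that difference.
\<close>
lemma triangle_series:
  assumes r: "0 < r" "r \<le> 1/2"
  shows "(\<lambda>M. \<Sum>k\<in>{-int M..int M}. of_real (triangle_coeff r k) * cis (2 * pi * (of_int k * x)))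
           \<longlonglongrightarrow> of_real (triangle r x)"
proof -
  define Q where "Q t = (\<Sum>k. cos (real k * t) / (real k)\<^sup>2)" for t
  define C where "C = (\<Sum>k. 1 / (real k)\<^sup>2)"
  define u where "u = x - of_int (round x)"
  define b where "b k = 1 / (pi\<^sup>2 * r) * (cos (real k * (2 * pi * x)) / (real k)\<^sup>2
      - cos (real k * (2 * pi * (x + r))) / (real k)\<^sup>2 / 2
      - cos (real k * (2 * pi * (x - r))) / (real k)\<^sup>2 / 2)" for k
  have d: "dist_int x = \<bar>u\<bar>" by (simp add: u_def dist_int_eq_round)
  have u2: "\<bar>u\<bar> \<le> 1/2" unfolding u_def using of_int_round_abs_le[of x] by linarith
  have Qsums: "(\<lambda>k. cos (real k * t) / (real k)\<^sup>2) sums Q t" for t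
    unfolding Q_def using cos_series_summable by (rule summable_sums)
  have per: "Q (2 * pi * (x + c)) = Q (2 * pi * (u + c))" for c
  proof -
    have "cos (real k * (2 * pi * (x + c))) = cos (real k * (2 * pi * (u + c)))" for k
    proof -
      have "real k * (2 * pi * (x + c)) = real k * (2 * pi * (u + c)) + 2 * pi * of_int (int k * round x)"
        by (simp add: u_def algebra_simps)
      then show ?thesis by (simp add: cos_add sin_int_2pin cos_int_2pin del: of_int_mult)
    qed
    then show ?thesis by (simp add: Q_def)
  qed
  have Qv: "Q (2 * pi * v) = C + pi\<^sup>2 * (v\<^sup>2 - \<bar>v\<bar>)" if "\<bar>v\<bar> \<le> 1" for v
    using cos_series_abs_le_one[OF that] by (simp add: Q_def C_def)
  have q1: "Q (2 * pi * x) = C + pi\<^sup>2 * (u\<^sup>2 - \<bar>u\<bar>)"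
    using per[of 0] Qv[of u] u2 by simp
  have q2: "Q (2 * pi * (x + r)) = C + pi\<^sup>2 * ((u + r)\<^sup>2 - \<bar>u + r\<bar>)"
    unfolding per by (rule Qv) (use u2 r in linarith)
  have q3: "Q (2 * pi * (x - r)) = C + pi\<^sup>2 * ((u - r)\<^sup>2 - \<bar>u - r\<bar>)"
    using per[of "-r"] Qv[of "u - r"] u2 r by simp
  have "b sums (1 / (pi\<^sup>2 * r) * (Q (2 * pi * x) - Q (2 * pi * (x + r)) / 2 - Q (2 * pi * (x - r)) / 2))"
    unfolding b_def by (intro sums_mult sums_diff sums_divide Qsums)
  also have "1 / (pi\<^sup>2 * r) * (Q (2 * pi * x) - Q (2 * pi * (x + r)) / 2 - Q (2 * pi * (x - r)) / 2) = triangle r x - r"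
  proof -
    have "Q (2 * pi * x) - Q (2 * pi * (x + r)) / 2 - Q (2 * pi * (x - r)) / 2
        = pi\<^sup>2 * (u\<^sup>2 - \<bar>u\<bar> - ((u + r)\<^sup>2 - \<bar>u + r\<bar>) / 2 - ((u - r)\<^sup>2 - \<bar>u - r\<bar>) / 2)"
      unfolding q1 q2 q3 by algebra
    also have "u\<^sup>2 - \<bar>u\<bar> - ((u + r)\<^sup>2 - \<bar>u + r\<bar>) / 2 - ((u - r)\<^sup>2 - \<bar>u - r\<bar>) / 2 = max 0 (r - \<bar>u\<bar>) - r\<^sup>2"
      using r by (simp add: power2_eq_square field_simps abs_if max_def)
    finally show ?thesis
      using r by (simp add: triangle_def d power2_eq_square field_simps max_def)
  qed
  finally have "(\<lambda>M. r + (\<Sum>k<Suc M. b k)) \<longlonglongrightarrow> r + (triangle r x - r)"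
    unfolding sums_def by (intro tendsto_add tendsto_const) (rule LIMSEQ_Suc)
  then have "(\<lambda>M. complex_of_real (r + (\<Sum>k<Suc M. b k))) \<longlonglongrightarrow> of_real (triangle r x)"
    by (intro tendsto_of_real) simp
  moreover have "(\<Sum>k\<in>{-int M..int M}. of_real (triangle_coeff r k) * cis (2 * pi * (of_int k * x)))
      = complex_of_real (r + (\<Sum>k<Suc M. b k))" for M
  proof -
    have alg: "1 / w * (a / z - b / z / 2 - c / z / 2) = 1 / (w * z) * (a - (b + c) / 2)" for a b c w z :: real
      by (simp only: divide_inverse inverse_mult_distrib distrib_left distrib_right left_diff_distrib right_diff_distrib mult_1_left mult_ac)
    have eq: "of_real (triangle_coeff r (int k)) * cis (2 * pi * (of_int (int k) * x))
        + of_real (triangle_coeff r (- int k)) * cis (2 * pi * (of_int (- int k) * x)) = complex_of_real (b k)"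
      if "k \<ge> 1" for k
    proof -
      have e: "triangle_coeff r (- int k) = triangle_coeff r (int k)" by (simp add: triangle_coeff_def)
      have "b k = 1 / (pi\<^sup>2 * r * (real k)\<^sup>2) * (cos (real k * (2 * pi * x))
          - (cos (real k * (2 * pi * (x + r))) + cos (real k * (2 * pi * (x - r)))) / 2)"
        unfolding b_def by (rule alg)
      also have "cos (real k * (2 * pi * (x + r))) + cos (real k * (2 * pi * (x - r)))
          = 2 * cos (real k * (2 * pi * x)) * cos (2 * (pi * r * real k))"
        by (simp add: cos_add cos_diff algebra_simps)
      also have "cos (2 * (pi * r * real k)) = 1 - 2 * (sin (pi * r * real k))\<^sup>2"
        by (rule cos_double_sin)
      finally have "b k = 2 * triangle_coeff r (int k) * cos (2 * pi * (real k * x))"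
        using that by (simp add: triangle_coeff_def field_simps)
      then show ?thesis by (intro complex_eqI) (simp_all add: e)
    qed
    have "b 0 = 0" by (simp add: b_def)
    then have "(\<Sum>k<Suc M. b k) = (\<Sum>k=1..M. b k)"
      by (subst sum.lessThan_Suc_shift) (simp add: sum.shift_bounds_Suc_ivl[symmetric] sum.atLeast1_atMost_eq)
    then show ?thesis
      unfolding sum_symmetric_int_interval using eq by (simp add: triangle_coeff_def)
  qed
  ultimately show ?thesis by simp
qed

lemma triangle_coeff_nonneg: "0 < r \<Longrightarrow> 0 \<le> triangle_coeff r k"
  by (simp add: triangle_coeff_def)

lemma triangle_coeff_le_radius:
  assumes "0 < r" shows "triangle_coeff r k \<le> r"
proof (cases "k = 0")
  case False
  have "(sin (pi * r * of_int k))\<^sup>2 \<le> (pi * r * of_int k)\<^sup>2"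
    using abs_sin_x_le_abs_x abs_le_square_iff by blast
  then have "triangle_coeff r k \<le> (pi * r * of_int k)\<^sup>2 / (pi\<^sup>2 * (of_int k)\<^sup>2 * r)"
    using False assms by (simp add: triangle_coeff_def divide_right_mono)
  also have "\<dots> = r" using False assms by (simp add: power2_eq_square)
  finally show ?thesis .
qed (simp add: triangle_coeff_def)

lemma triangle_coeff_le_decay:
  assumes "0 < r" "k \<noteq> 0" shows "triangle_coeff r k \<le> 1 / (r * (of_int k)\<^sup>2)"
proof -
  have "(sin (pi * r * of_int k))\<^sup>2 \<le> 1" by (simp add: abs_square_le_1)
  also have "1 \<le> pi\<^sup>2" using pi_ge_two by (simp add: power2_eq_square mult_ge1_I)
  finally show ?thesis using assms by (simp add: triangle_coeff_def field_simps)
qed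

text \<open>
  This merges the bounds r and 1/(r k^2) into one that is monotone and can be summed by comparison
  with arctan.
\<close>
lemma triangle_coeff_le_Lorentz:
  assumes "0 < r" "0 \<le> t" "t \<le> \<bar>of_int k\<bar>" shows "triangle_coeff r k \<le> 2 * r / (1 + (r * t)\<^sup>2)"
proof -
  have p: "1 + (r * t)\<^sup>2 > 0" by (simp add: add_pos_nonneg)
  have "triangle_coeff r k * (r * t)\<^sup>2 \<le> r"
  proof (cases "k = 0")
    case False
    have "triangle_coeff r k * (r * t)\<^sup>2 \<le> triangle_coeff r k * (r * of_int k)\<^sup>2"
      using assms triangle_coeff_nonneg[of r k] by (intro mult_left_mono) (auto simp: power_mult_distrib abs_le_square_iff[symmetric])
    also have "\<dots> \<le> 1 / (r * (of_int k)\<^sup>2) * (r * of_int k)\<^sup>2"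
      using triangle_coeff_le_decay[OF assms(1) False] by (intro mult_right_mono) auto
    also have "\<dots> = r" using assms False by (simp add: power2_eq_square)
    finally show ?thesis .
  qed (use assms in auto)
  then have "triangle_coeff r k * (1 + (r * t)\<^sup>2) \<le> 2 * r"
    using triangle_coeff_le_radius[OF assms(1), of k] by (simp add: distrib_left)
  then show ?thesis using p by (simp add: pos_le_divide_eq)
qed

lemma finite_int_subset_symmetric_interval:
  assumes "finite (F :: int set)" obtains M where "F \<subseteq> {-int M..int M}"
proof -
  from assms obtain m where m: "\<And>k. k \<in> F \<Longrightarrow> \<bar>k\<bar> \<le> m"
    using finite_imageI[OF assms, of abs] Max_ge[of "abs ` F"] by (metis imageI)
  have "F \<subseteq> {-int (nat \<bar>m\<bar>)..int (nat \<bar>m\<bar>)}" using m by fastforce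
  then show ?thesis using that by blast
qed

text \<open>
  The coefficients are nonnegative, so every finite sum is at most the value of the series at 0,
  which is the height of the triangle.
\<close>
lemma triangle_coeff_sum_le_1:
  assumes r: "0 < r" "r \<le> 1/2" and "finite F" shows "sum (triangle_coeff r) F \<le> 1"
proof -
  obtain M0 where M0: "F \<subseteq> {-int M0..int M0}" using assms finite_int_subset_symmetric_interval by blast
  have "(\<lambda>M. Re (\<Sum>k\<in>{-int M..int M}. of_real (triangle_coeff r k) * cis (2 * pi * (of_int k * 0))))
           \<longlonglongrightarrow> Re (of_real (triangle r 0))"
    by (intro tendsto_Re triangle_series r)
  then have lim: "(\<lambda>M. \<Sum>k\<in>{-int M..int M}. triangle_coeff r k) \<longlonglongrightarrow> 1"
    by (simp add: triangle_def dist_int_eq_round)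
  have "\<forall>\<^sub>F M in sequentially. sum (triangle_coeff r) F \<le> (\<Sum>k\<in>{-int M..int M}. triangle_coeff r k)"
    unfolding eventually_sequentially using M0 r
    by (intro exI[of _ M0] allI impI sum_mono2) (auto simp: triangle_coeff_nonneg)
  then show ?thesis by (rule tendsto_lowerbound[OF lim _ trivial_limit_sequentially])
qed

text \<open>
  An upper bound for the triangle coefficients on the whole cell [h q, h (q+1)). Points of that cell
  have absolute value at least h (|q| - 1); the maximum with 0 covers the cell q = 0.
\<close>
definition Lorentz_cell :: "real \<Rightarrow> real \<Rightarrow> int \<Rightarrow> real" where
  "Lorentz_cell r h q = 2 * r / (1 + (r * (h * max 0 (\<bar>of_int q\<bar> - 1)))\<^sup>2)"

lemma Lorentz_cell_nonneg: "0 < r \<Longrightarrow> 0 \<le> Lorentz_cell r h q"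
  by (simp add: Lorentz_cell_def add_nonneg_nonneg)

lemma triangle_coeff_le_Lorentz_cell:
  assumes "0 < r" "0 < h" shows "triangle_coeff r k \<le> Lorentz_cell r h \<lfloor>of_int k / h\<rfloor>"
  unfolding Lorentz_cell_def
proof (rule triangle_coeff_le_Lorentz)
  define q where "q = \<lfloor>of_int k / h\<rfloor>"
  have q: "h * of_int q \<le> of_int k" "of_int k < h * (of_int q + 1)"
    using floor_correct[of "of_int k / h"] assms unfolding q_def[symmetric] by (simp_all add: field_simps)
  have "h * (\<bar>of_int q\<bar> - 1) \<le> \<bar>of_int k\<bar>"
  proof (cases "q \<ge> 0")
    case True
    then show ?thesis using q assms by (simp add: algebra_simps) 
  next
    case False
    then show ?thesis using q assms by (simp add: algebra_simps)
  qed
  then show "h * max 0 (\<bar>of_int \<lfloor>real_of_int k / h\<rfloor>\<bar> - 1) \<le> \<bar>real_of_int k\<bar>"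
    unfolding q_def[symmetric] by (simp add: max_def)
qed (use assms in auto)

text \<open>
  Each term is at most an increment of (2/h) arctan (r h u), because the derivative of arctan is
  decreasing on the positive axis, and the increments telescope. The bound does not
  depend on r: this uniformity lets boxes of arbitrary proportions be treated alike.
\<close>
lemma Lorentz_sum_le:
  assumes "0 < r" "0 < h" shows "(\<Sum>u=1..U. 2 * r / (1 + (r * (h * real u))\<^sup>2)) \<le> pi / h"
proof -
  define c where "c = r * h"
  have c: "c > 0" using assms by (simp add: c_def)
  have step: "c / (1 + (c * real (Suc u))\<^sup>2) \<le> arctan (c * real (Suc u)) - arctan (c * real u)" for u
  proof -
    have "\<exists>z>c * real u. z < c * real (Suc u) \<and> arctan (c * real (Suc u)) - arctan (c * real u)
        = (c * real (Suc u) - c * real u) * inverse (1 + z\<^sup>2)"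
      by (rule MVT2) (use c in \<open>auto intro: DERIV_arctan\<close>)
    then obtain z where z: "z > c * real u" "z < c * real (Suc u)"
      "arctan (c * real (Suc u)) - arctan (c * real u) = c / (1 + z\<^sup>2)"
      by (auto simp: algebra_simps divide_inverse)
    have "0 \<le> z" using z(1) c by (smt (verit) mult_nonneg_nonneg of_nat_0_le_iff)
    then have "z\<^sup>2 \<le> (c * real (Suc u))\<^sup>2" using z by (intro power_mono) auto
    then show ?thesis unfolding z(3) using c by (intro divide_left_mono) (auto simp: add_pos_nonneg)
  qed
  have "(\<Sum>u=1..U. c / (1 + (c * real u)\<^sup>2)) \<le> arctan (c * real U)"
  proof (induction U)
    case (Suc U)
    then show ?case using step[of U] by simp
  qed simp
  also have "\<dots> \<le> pi / 2" using arctan_ubound[of "c * real U"] by simp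
  finally have "2 / h * (\<Sum>u=1..U. c / (1 + (c * real u)\<^sup>2)) \<le> 2 / h * (pi / 2)"
    using assms by (intro mult_left_mono) auto
  then show ?thesis using assms by (simp add: sum_distrib_left c_def mult.assoc)
qed

lemma Lorentz_cell_outer_sum_le:
  assumes "0 < r" "0 < h" "finite F" "\<And>q. q \<in> F \<Longrightarrow> \<bar>q\<bar> \<ge> 2"
  shows "sum (Lorentz_cell r h) F \<le> 2 * pi / h"
proof -
  obtain M where M: "F \<subseteq> {-int M..int M}" using assms finite_int_subset_symmetric_interval by blast
  define f where "f q = (if \<bar>q\<bar> \<ge> 2 then Lorentz_cell r h q else 0)" for q
  have "sum (Lorentz_cell r h) F = sum f F" using assms(4) by (intro sum.cong) (auto simp: f_def)
  also have "\<dots> \<le> sum f {-int (Suc M)..int (Suc M)}"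
    using M assms(1) by (intro sum_mono2) (auto simp: f_def Lorentz_cell_nonneg)
  also have "\<dots> = (\<Sum>k=1..Suc M. f (int k) + f (- int k))"
    unfolding sum_symmetric_int_interval by (simp only: f_def abs_zero) simp
  also have "\<dots> = (\<Sum>k<Suc M. f (int (Suc k)) + f (- int (Suc k)))"
    unfolding One_nat_def by (rule sum.atLeast1_atMost_eq)
  also have "\<dots> = (\<Sum>k<M. f (int (Suc (Suc k))) + f (- int (Suc (Suc k))))"
    by (subst sum.lessThan_Suc_shift) (simp add: f_def)
  also have "\<dots> = (\<Sum>k<M. 2 * (2 * r / (1 + (r * (h * real (Suc k)))\<^sup>2)))"
    by (intro sum.cong) (auto simp: f_def Lorentz_cell_def)
  also have "\<dots> = 2 * (\<Sum>u=1..M. 2 * r / (1 + (r * (h * real u))\<^sup>2))"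
    by (simp only: sum_distrib_left[symmetric] sum.atLeast1_atMost_eq One_nat_def)
  also have "\<dots> \<le> 2 * (pi / h)" using Lorentz_sum_le[OF assms(1,2), of M] by simp
  finally show ?thesis by simp
qed

lemma Lorentz_cell_sum_le:
  assumes "0 < r" "0 < h" "finite F"
  shows "sum (Lorentz_cell r h) F \<le> 6 * r + 2 * pi / h"
proof -
  have "sum (Lorentz_cell r h) F \<le> sum (Lorentz_cell r h) ({-1,0,1} \<union> {q\<in>F. \<bar>q\<bar> \<ge> 2})"
    using assms by (intro sum_mono2) (auto simp: Lorentz_cell_nonneg)
  also have "\<dots> = sum (Lorentz_cell r h) {-1,0,1} + sum (Lorentz_cell r h) {q\<in>F. \<bar>q\<bar> \<ge> 2}"
    using assms by (intro sum.union_disjoint) auto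
  also have "\<dots> \<le> 6 * r + 2 * pi / h"
  proof (rule add_mono)
    show "sum (Lorentz_cell r h) {-1,0,1} \<le> 6 * r" by (simp add: Lorentz_cell_def)
    show "sum (Lorentz_cell r h) {q\<in>F. \<bar>q\<bar> \<ge> 2} \<le> 2 * pi / h"
      by (rule Lorentz_cell_outer_sum_le) (use assms in auto)
  qed
  finally show ?thesis .
qed

text \<open>
  Interpolating between the bounds r and 1/(r k^2) with weights 3/8 and 5/8 leaves
  r^(-1/4) |k|^(-5/4). Of the power of |k|, -1/8 is spent on the tail and -9/8 on convergence.
  The weak exponent of r matters: with r at least m^(-2) the loss is only m^(1/2), which a decay
  m^(-s) with s > 2 absorbs.
\<close>
lemma triangle_coeff_tail_le:
  "\<exists>C>0. \<forall>r T F. 0 < r \<longrightarrow> 0 < T \<longrightarrow> finite F \<longrightarrow> (\<forall>k\<in>F. T < \<bar>real_of_int k\<bar>) \<longrightarrow>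
     sum (triangle_coeff r) F \<le> C * (r powr (-1/4) * T powr (-1/8))"
proof -
  define S where "S = (\<Sum>k. real k powr (-9/8))"
  have sm: "summable (\<lambda>k. real k powr (-9/8))" by (simp add: summable_real_powr_iff)
  have S: "S \<ge> 0" unfolding S_def by (intro suminf_nonneg sm) auto
  show ?thesis
  proof (intro exI[of _ "2 * S + 1"] conjI allI impI)
    fix r T :: real and F :: "int set"
    assume r: "0 < r" and T: "0 < T" and F: "finite F" "\<forall>k\<in>F. T < \<bar>real_of_int k\<bar>"
    define w where "w k = \<bar>real_of_int k\<bar> powr (-9/8)" for k
    have pt: "triangle_coeff r k \<le> (r powr (-1/4) * T powr (-1/8)) * w k" if "k \<in> F" for k
    proof -
      define a where "a = triangle_coeff r k"
      define z where "z = \<bar>real_of_int k\<bar>"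
      have z: "T < z" "z > 0" using F(2) T that by (auto simp: z_def)
      have a: "0 \<le> a" "a \<le> r" "a \<le> 1 / (r * z\<^sup>2)"
        using triangle_coeff_nonneg triangle_coeff_le_radius triangle_coeff_le_decay[of r k] r z
        by (auto simp: a_def z_def)
      have "a = a powr (3/8) * a powr (5/8)" using a by (simp flip: powr_add)
      also have "\<dots> \<le> r powr (3/8) * (1 / (r * z\<^sup>2)) powr (5/8)"
        using a by (intro mult_mono powr_mono2) auto
      also have "1 / (r * z\<^sup>2) = r powr (-1) * z powr (-2)"
        using r z by (simp add: powr_minus divide_inverse powr_numeral)
      also have "(r powr (-1) * z powr (-2)) powr (5/8) = r powr (-5/8) * z powr (-5/4)"
        by (simp only: powr_mult powr_powr) simp
      also have "r powr (3/8) * (r powr (-5/8) * z powr (-5/4)) = r powr (-1/4) * z powr (-5/4)"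
        by (simp flip: powr_add mult.assoc)
      also have "z powr (-5/4) = z powr (-1/8) * z powr (-9/8)"
        by (simp flip: powr_add)
      also have "z powr (-1/8) \<le> T powr (-1/8)" using z T by (intro powr_mono2') auto
      finally show ?thesis by (simp add: a_def w_def z_def mult.assoc mult_left_mono mult_right_mono)
    qed
    have "sum (triangle_coeff r) F \<le> (\<Sum>k\<in>F. (r powr (-1/4) * T powr (-1/8)) * w k)"
      using pt by (rule sum_mono)
    also have "\<dots> = (r powr (-1/4) * T powr (-1/8)) * sum w F" by (simp add: sum_distrib_left)
    also have "\<dots> \<le> (r powr (-1/4) * T powr (-1/8)) * (2 * S + 1)"
    proof (rule mult_left_mono)
      obtain M where M: "F \<subseteq> {-int M..int M}" using F finite_int_subset_symmetric_interval by blast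
      have "sum w F \<le> sum w {-int M..int M}" using M by (intro sum_mono2) (auto simp: w_def)
      also have "\<dots> = 2 * (\<Sum>k=1..M. real k powr (-9/8))"
        by (simp add: sum_symmetric_int_interval w_def sum_distrib_left)
      also have "(\<Sum>k=1..M. real k powr (-9/8)) \<le> S"
        unfolding S_def by (intro sum_le_suminf sm) auto
      finally show "sum w F \<le> 2 * S + 1" by simp
    qed simp
    finally show "sum (triangle_coeff r) F \<le> (2 * S + 1) * (r powr (-1/4) * T powr (-1/8))"
      by (simp only: mult.commute)
  qed (use S in auto)
qed

section \<open>Products over the coordinates\<close>

definition freq_box :: "nat \<Rightarrow> ('n::finite \<Rightarrow> int) set" where
  "freq_box M = (\<Pi>\<^sub>E i\<in>UNIV. {-int M..int M})"

text \<open>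
  Frequencies are functions rather than vectors so that boxes of them are dependent products and
  products of one-dimensional sums can be expanded over them.
\<close>
definition freq_vec :: "('n::finite \<Rightarrow> int) \<Rightarrow> real ^ 'n" where
  "freq_vec k = (\<chi> i. of_int (k i))"

definition box_coeff :: "('n::finite \<Rightarrow> int \<Rightarrow> real) \<Rightarrow> ('n \<Rightarrow> int) \<Rightarrow> real" where
  "box_coeff c k = (\<Prod>i\<in>UNIV. c i (k i))"

definition trig_poly :: "('n::finite \<Rightarrow> int \<Rightarrow> real) \<Rightarrow> nat \<Rightarrow> real ^ 'n \<Rightarrow> complex" where
  "trig_poly c M x = (\<Sum>k\<in>freq_box M. of_real (box_coeff c k) * cis (2 * pi * (freq_vec k \<bullet> x)))"

lemma finite_freq_box [simp]: "finite (freq_box M)"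
  by (simp add: freq_box_def finite_PiE)

lemma cis_sum: "finite A \<Longrightarrow> cis (sum f A) = (\<Prod>i\<in>A. cis (f i))"
  by (induction A rule: finite_induct) (auto simp: cis_mult[symmetric])

lemma trig_poly_eq_prod:
  fixes c :: "'n::finite \<Rightarrow> int \<Rightarrow> real"
  shows "trig_poly c M x = (\<Prod>i\<in>UNIV. \<Sum>j\<in>{-int M..int M}. of_real (c i j) * cis (2 * pi * (of_int j * x $ i)))"
proof -
  have "(\<Prod>i\<in>UNIV. \<Sum>j\<in>{-int M..int M}. of_real (c i j) * cis (2 * pi * (of_int j * x $ i)))
      = (\<Sum>k\<in>freq_box M. \<Prod>i\<in>UNIV. of_real (c i (k i)) * cis (2 * pi * (of_int (k i) * x $ i)))"
    unfolding freq_box_def by (rule prod_sum_PiE) auto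
  also have "\<dots> = trig_poly c M x"
    unfolding trig_poly_def
    by (intro sum.cong refl)
       (simp add: prod.distrib box_coeff_def freq_vec_def inner_vec_def cis_sum sum_distrib_left mult.assoc flip: of_real_prod)
  finally show ?thesis by simp
qed

lemma trig_poly_tendsto:
  fixes c :: "'n::finite \<Rightarrow> int \<Rightarrow> real"
  assumes "\<And>i. (\<lambda>M. \<Sum>j\<in>{-int M..int M}. of_real (c i j) * cis (2 * pi * (of_int j * x $ i)))
             \<longlonglongrightarrow> complex_of_real (g i (x $ i))"
  shows "(\<lambda>M. trig_poly c M x) \<longlonglongrightarrow> of_real (\<Prod>i\<in>UNIV. g i (x $ i))"
  unfolding trig_poly_eq_prod of_real_prod by (intro tendsto_prod assms)

lemma sum_prod_le:
  fixes b :: "'n::finite \<Rightarrow> int \<Rightarrow> real" and Q :: "('n \<Rightarrow> int) set"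
  assumes "finite Q" "\<And>i j. 0 \<le> b i j"
    and "\<And>i F. finite F \<Longrightarrow> sum (b i) F \<le> C i"
  shows "(\<Sum>q\<in>Q. \<Prod>i\<in>UNIV. b i (q i)) \<le> (\<Prod>i\<in>UNIV. C i)"
proof -
  define F where "F i = (\<lambda>q. q i) ` Q" for i
  have fin: "finite (F i)" for i using assms(1) by (simp add: F_def)
  have "(\<Sum>q\<in>Q. \<Prod>i\<in>UNIV. b i (q i)) \<le> (\<Sum>q\<in>PiE UNIV F. \<Prod>i\<in>UNIV. b i (q i))"
    by (rule sum_mono2[OF finite_PiE]) (use fin in \<open>auto simp: F_def intro!: prod_nonneg assms(2)\<close>)
  also have "\<dots> = (\<Prod>i\<in>UNIV. \<Sum>j\<in>F i. b i j)"
    by (rule prod_sum_PiE[symmetric]) (auto simp: fin)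
  also have "\<dots> \<le> (\<Prod>i\<in>UNIV. C i)"
    by (intro prod_mono conjI sum_nonneg assms fin)
  finally show ?thesis .
qed

text \<open>
  A union bound over the coordinate in which the restriction P holds: that coordinate contributes
  the small factor \<delta> and all others at most C.
\<close>
lemma sum_prod_restricted_le:
  fixes b :: "'n::finite \<Rightarrow> int \<Rightarrow> real" and Q :: "('n \<Rightarrow> int) set"
  assumes Q: "finite Q" "\<And>q. q \<in> Q \<Longrightarrow> \<exists>i. P (q i)"
    and b: "\<And>i j. 0 \<le> b i j"
    and C: "\<And>i F. finite F \<Longrightarrow> sum (b i) F \<le> C" "C \<ge> 1"
    and \<delta>: "\<And>i F. finite F \<Longrightarrow> (\<And>j. j \<in> F \<Longrightarrow> P j) \<Longrightarrow> sum (b i) F \<le> \<delta>"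
  shows "(\<Sum>q\<in>Q. \<Prod>i\<in>UNIV. b i (q i)) \<le> real CARD('n) * \<delta> * C ^ CARD('n)"
proof -
  have \<delta>0: "\<delta> \<ge> 0" using \<delta>[of "{}"] by simp
  \<comment> \<open>The weights with the restriction enforced in the coordinate i0 only.\<close>
  define b' where "b' i0 i j = (if i = i0 \<and> \<not> P j then 0 else b i j)" for i0 i j
  have b'0: "0 \<le> b' i0 i j" for i0 i j by (simp add: b'_def b)
  have "(\<Sum>q\<in>Q. \<Prod>i\<in>UNIV. b i (q i)) \<le> (\<Sum>q\<in>Q. \<Sum>i0\<in>UNIV. \<Prod>i\<in>UNIV. b' i0 i (q i))"
  proof (rule sum_mono)
    fix q assume "q \<in> Q"
    then obtain i0 where "P (q i0)" using Q by blast
    then have "(\<Prod>i\<in>UNIV. b i (q i)) = (\<Prod>i\<in>UNIV. b' i0 i (q i))"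
      by (intro prod.cong) (auto simp: b'_def)
    also have "\<dots> \<le> (\<Sum>i0\<in>UNIV. \<Prod>i\<in>UNIV. b' i0 i (q i))"
      by (intro member_le_sum prod_nonneg b'0) auto
    finally show "(\<Prod>i\<in>UNIV. b i (q i)) \<le> (\<Sum>i0\<in>UNIV. \<Prod>i\<in>UNIV. b' i0 i (q i))" .
  qed
  also have "\<dots> = (\<Sum>i0\<in>UNIV. \<Sum>q\<in>Q. \<Prod>i\<in>UNIV. b' i0 i (q i))" by (rule sum.swap)
  also have "\<dots> \<le> (\<Sum>i0\<in>(UNIV::'n set). \<delta> * C ^ CARD('n))"
  proof (rule sum_mono)
    fix i0 :: 'n
    have "(\<Sum>q\<in>Q. \<Prod>i\<in>UNIV. b' i0 i (q i)) \<le> (\<Prod>i\<in>UNIV. if i = i0 then \<delta> else C)"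
    proof (rule sum_prod_le[OF Q(1) b'0])
      fix i and F :: "int set" assume F: "finite F"
      show "sum (b' i0 i) F \<le> (if i = i0 then \<delta> else C)"
      proof (cases "i = i0")
        case True
        have "sum (b' i0 i) F = sum (b i) {j\<in>F. P j}"
          using F True by (simp add: b'_def sum.If_cases Int_def conj_commute)
        also have "\<dots> \<le> \<delta>" using F by (intro \<delta>) auto
        finally show ?thesis using True by simp
      next
        case False
        then show ?thesis using C(1)[OF F, of i] by (simp add: b'_def)
      qed
    qed
    also have "\<dots> = \<delta> * C ^ (CARD('n) - 1)"
      by (simp add: prod.If_cases Collect_neg_eq[symmetric] Compl_eq_Diff_UNIV)
    also have "\<dots> \<le> \<delta> * C ^ CARD('n)"
      using \<delta>0 C(2) by (intro mult_left_mono power_increasing) auto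
    finally show "(\<Sum>q\<in>Q. \<Prod>i\<in>UNIV. b' i0 i (q i)) \<le> \<delta> * C ^ CARD('n)" .
  qed
  finally show ?thesis by simp
qed

section \<open>Expansion along a lacunary sequence of matrices\<close>

text \<open>
  An expanding B is onto, so with x = B w one has |x|^2 = <B^T x, w> and |w| \<le> |x| / D.
\<close>
lemma expanding_transpose:
  fixes B :: "real ^ 'n::finite ^ 'n"
  assumes "D > 0" and B: "\<And>x. norm (B *v x) \<ge> D * norm x"
  shows "norm (transpose B *v x) \<ge> D * norm x"
proof -
  have "inj ((*v) B)"
  proof (rule linear_injective_0[THEN iffD2, rule_format])
    show "linear ((*v) B)" by simp
    fix x assume "B *v x = 0"
    then have "D * norm x \<le> 0" using B[of x] by simp
    then show "x = 0" using \<open>D > 0\<close> by (simp add: mult_le_0_iff)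
  qed
  then have "surj ((*v) B)" by (simp add: linear_injective_imp_surjective)
  then obtain w where w: "x = B *v w" by (metis surjD)
  have "(norm x)\<^sup>2 = (transpose B *v x) \<bullet> w"
    by (simp add: w power2_norm_eq_inner dot_lmul_matrix[symmetric] vector_transpose_matrix)
  also have "\<dots> \<le> norm (transpose B *v x) * norm w" by (rule norm_cauchy_schwarz)
  finally have 1: "(norm x)\<^sup>2 \<le> norm (transpose B *v x) * norm w" .
  have 2: "D * norm w \<le> norm x" using B[of w] w by simp
  show ?thesis
  proof (cases "norm x = 0")
    case False
    have "D * norm x * norm x = D * (norm x)\<^sup>2" by (simp add: power2_eq_square)
    also have "\<dots> \<le> norm (transpose B *v x) * (D * norm w)" using 1 \<open>D > 0\<close> by (simp add: mult.left_commute)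
    also have "\<dots> \<le> norm (transpose B *v x) * norm x" using 2 by (intro mult_left_mono) auto
    finally show ?thesis using False by (simp add: mult_le_cancel_right)
  qed simp
qed

lemma smallest_singular_value_le:
  fixes A :: "real ^ 'n::finite ^ 'n"
  shows "smallest_singular_value A * norm x \<le> norm (A *v x)"
proof (cases "x = 0")
  case False
  define u where "u = x /\<^sub>R norm x"
  have u: "norm u = 1" "x = norm x *\<^sub>R u" using False by (auto simp: u_def)
  have "smallest_singular_value A \<le> norm (A *v u)"
    unfolding smallest_singular_value_def
    by (rule cInf_lower) (use u in \<open>auto intro!: bdd_belowI[where m = 0]\<close>)
  then have "smallest_singular_value A * norm x \<le> norm (A *v u) * norm x" by (rule mult_right_mono) simp
  also have "\<dots> = norm (A *v x)"
    by (subst (2) u(2)) (simp add: matrix_vector_mult_scaleR)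
  finally show ?thesis .
qed simp

text \<open>
  A kernel vector would be an eigenvector for the eigenvalue 0.
\<close>
lemma expanding_integral_matrix_invertible:
  fixes A :: "real ^ 'n::finite ^ 'n"
  assumes "expanding_integral_matrix A" shows "invertible A"
proof (rule ccontr)
  assume "\<not> invertible A"
  then obtain v where v: "v \<noteq> 0" "A *v v = 0"
    using invertible_left_inverse matrix_left_invertible_ker by blast
  define w :: "complex ^ 'n" where "w = (\<chi> i. of_real (v $ i))"
  have "w \<noteq> 0" using v(1) by (auto simp: w_def vec_eq_iff)
  moreover have "map_matrix complex_of_real A *v w = 0 *s w"
  proof (rule vec_eq_iff[THEN iffD2, rule_format])
    fix i
    have "(map_matrix complex_of_real A *v w) $ i = of_real ((A *v v) $ i)"
      by (simp add: map_matrix_def matrix_vector_mult_def w_def)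
    then show "(map_matrix complex_of_real A *v w) $ i = (0 *s w) $ i" using v(2) by simp
  qed
  ultimately have "complex_eigenvalue A 0" unfolding complex_eigenvalue_def by blast
  then show False using assms by (auto simp: expanding_integral_matrix_def)
qed

lemma matrix_inv_inverse:
  fixes B :: "real ^ 'n::finite ^ 'n"
  assumes "invertible B" shows "B ** matrix_inv B = mat 1" "matrix_inv B ** B = mat 1"
proof -
  have "B ** matrix_inv B = mat 1 \<and> matrix_inv B ** B = mat 1"
    unfolding matrix_inv_def by (rule someI_ex) (use assms in \<open>simp add: invertible_def\<close>)
  then show "B ** matrix_inv B = mat 1" "matrix_inv B ** B = mat 1" by auto
qed

locale lacunary_matrices =
  fixes A :: "nat \<Rightarrow> real ^ 'n::finite ^ 'n" and K :: real
  assumes inv: "\<And>n. n \<ge> 1 \<Longrightarrow> invertible (A n)"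
    and K1: "K > 1"
    and sv: "\<And>n. n \<ge> 1 \<Longrightarrow> smallest_singular_value (A (Suc n) ** matrix_inv (A n)) \<ge> K"
begin

text \<open>
  Applying A_(n+1) A_n^(-1) to A_n x stretches it by K; iterate.
\<close>
lemma growth:
  assumes "1 \<le> m" "m \<le> n" shows "K ^ (n - m) * norm (A m *v x) \<le> norm (A n *v x)"
  using assms(2)
proof (induction n rule: dec_induct)
  case (step n)
  have "n \<ge> 1" using step assms by simp
  have "K ^ (Suc n - m) * norm (A m *v x) = K * (K ^ (n - m) * norm (A m *v x))"
    using step by (simp add: Suc_diff_le)
  also have "\<dots> \<le> K * norm (A n *v x)" using step K1 by (intro mult_left_mono) auto
  also have "\<dots> \<le> smallest_singular_value (A (Suc n) ** matrix_inv (A n)) * norm (A n *v x)"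
    using sv[OF \<open>n \<ge> 1\<close>] by (intro mult_right_mono) auto
  also have "\<dots> \<le> norm ((A (Suc n) ** matrix_inv (A n)) *v (A n *v x))" by (rule smallest_singular_value_le)
  also have "(A (Suc n) ** matrix_inv (A n)) *v (A n *v x) = A (Suc n) *v x"
    using inv[OF \<open>n \<ge> 1\<close>]
    by (simp add: matrix_vector_mul_assoc matrix_mul_assoc[symmetric] matrix_inv_inverse)
  finally show ?case .
qed simp

text \<open>
  The transpose of B = A_n A_m^(-1): it is the transpose that acts on frequencies.
\<close>
definition ratio :: "nat \<Rightarrow> nat \<Rightarrow> real ^ 'n ^ 'n" where
  "ratio m n = transpose (A n ** matrix_inv (A m))"

lemma ratio_expands:
  assumes "1 \<le> m" "m \<le> n" shows "K ^ (n - m) * norm x \<le> norm (ratio m n *v x)"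
  unfolding ratio_def
proof (rule expanding_transpose)
  show "K ^ (n - m) > 0" using K1 by simp
  fix x :: "real ^ 'n"
  have "K ^ (n - m) * norm (A m *v (matrix_inv (A m) *v x)) \<le> norm (A n *v (matrix_inv (A m) *v x))"
    by (rule growth[OF assms])
  then show "K ^ (n - m) * norm x \<le> norm ((A n ** matrix_inv (A m)) *v x)"
    using inv[OF assms(1)] by (simp add: matrix_vector_mul_assoc matrix_inv_inverse)
qed

lemma transpose_factor:
  assumes "1 \<le> m" shows "transpose (A n) *v x = transpose (A m) *v (ratio m n *v x)"
proof -
  have "A n = (A n ** matrix_inv (A m)) ** A m"
    using inv[OF assms] by (simp add: matrix_mul_assoc[symmetric] matrix_inv_inverse)
  then have "transpose (A n) = transpose (A m) ** ratio m n"
    unfolding ratio_def by (metis matrix_transpose_mul)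
  then show ?thesis by (simp add: matrix_vector_mul_assoc)
qed

lemma transpose_growth:
  "\<exists>c>0. \<forall>n\<ge>1. \<forall>x. c * K ^ n * norm x \<le> norm (transpose (A n) *v x)"
proof -
  have lin: "linear ((*v) (A 1))" by simp
  have "inj ((*v) (A 1))"
    using inv[of 1] by (simp add: inj_matrix_vector_mult)
  then obtain b where b: "b > 0" "\<And>x. b * norm x \<le> norm (A 1 *v x)"
    using linear_inj_bounded_below_pos[OF lin] by (metis mult.commute)
  show ?thesis
  proof (intro exI[of _ "b / K"] conjI allI impI)
    fix n :: nat and x :: "real ^ 'n" assume n: "n \<ge> 1"
    have "K ^ (n - 1) * b * norm x \<le> norm (transpose (A n) *v x)"
    proof (rule expanding_transpose)
      show "K ^ (n - 1) * b > 0" using K1 b by simp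
      fix x :: "real ^ 'n"
      have "K ^ (n - 1) * b * norm x \<le> K ^ (n - 1) * norm (A 1 *v x)"
        using b(2)[of x] K1 by (simp add: mult.assoc mult_left_mono)
      also have "\<dots> \<le> norm (A n *v x)" using growth[of 1 n x] n by simp
      finally show "K ^ (n - 1) * b * norm x \<le> norm (A n *v x)" .
    qed
    moreover have "K ^ (n - 1) = K ^ n / K" using n K1 by (cases n) auto
    ultimately show "b / K * K ^ n * norm x \<le> norm (transpose (A n) *v x)" by (simp add: mult_ac)
  qed (use b K1 in auto)
qed

end

section \<open>Correlation of two frequency lattices\<close>

lemma norm_vec_le_of_components:
  fixes x :: "real ^ 'n::finite"
  assumes "\<And>i. \<bar>x $ i\<bar> \<le> B" "0 \<le> B" shows "norm x \<le> sqrt (real CARD('n)) * B"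
proof -
  have "(\<Sum>i\<in>UNIV. (x $ i)\<^sup>2) \<le> (\<Sum>i\<in>(UNIV::'n set). B\<^sup>2)"
    using assms by (intro sum_mono) (simp add: abs_le_square_iff[symmetric])
  then have "norm x \<le> sqrt (real CARD('n) * B\<^sup>2)" by (simp add: norm_vec_def L2_set_def)
  then show ?thesis using assms by (simp add: real_sqrt_mult)
qed

lemma freq_vec_diff_ge_1:
  assumes "k \<noteq> l" shows "1 \<le> norm (freq_vec k - freq_vec l)"
proof -
  obtain i where "k i \<noteq> l i" using assms by blast
  then have "1 \<le> \<bar>real_of_int (k i) - real_of_int (l i)\<bar>" by linarith
  also have "\<dots> = \<bar>(freq_vec k - freq_vec l) $ i\<bar>" by (simp add: freq_vec_def)
  also have "\<dots> \<le> norm (freq_vec k - freq_vec l)" by (rule component_le_norm_cart)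
  finally show ?thesis .
qed

lemma freq_vec_ge_1: "k \<noteq> (\<lambda>_. 0) \<Longrightarrow> 1 \<le> norm (freq_vec k)"
  using freq_vec_diff_ge_1[of k "\<lambda>_. 0"] by (simp add: freq_vec_def zero_vec_def[symmetric])

abbreviation triangle_box_coeff :: "('n::finite \<Rightarrow> real) \<Rightarrow> ('n \<Rightarrow> int) \<Rightarrow> real" where
  "triangle_box_coeff r \<equiv> box_coeff (\<lambda>i. triangle_coeff (r i))"

context
  fixes r :: "'n::finite \<Rightarrow> real"
  assumes r: "\<And>i. 0 < r i" "\<And>i. r i \<le> 1/2"
begin

lemma triangle_box_coeff_nonneg: "0 \<le> triangle_box_coeff r k"
  unfolding box_coeff_def using r triangle_coeff_nonneg by (intro prod_nonneg) auto

lemma triangle_box_coeff_le: "triangle_box_coeff r k \<le> (\<Prod>i\<in>UNIV. r i)"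
  unfolding box_coeff_def using r triangle_coeff_nonneg triangle_coeff_le_radius by (intro prod_mono) auto

lemma triangle_box_coeff_sum_le_1:
  assumes "finite F" shows "sum (triangle_box_coeff r) F \<le> 1"
proof -
  have "sum (triangle_box_coeff r) F \<le> (\<Prod>i\<in>(UNIV::'n set). 1)"
    unfolding box_coeff_def
    using assms r triangle_coeff_nonneg triangle_coeff_sum_le_1 by (intro sum_prod_le) auto
  then show ?thesis by simp
qed

end

text \<open>
  A vector longer than D/2 has a coordinate larger than D / (2 sqrt d), so the one-dimensional tail
  bound applies in that coordinate.
\<close>
lemma triangle_box_coeff_tail:
  "\<exists>C>0. \<forall>(r :: 'n::finite \<Rightarrow> real) \<rho> D F.
     (\<forall>i. 0 < r i \<and> r i \<le> 1/2 \<and> \<rho> \<le> r i) \<longrightarrow> 0 < \<rho> \<longrightarrow> 0 < D \<longrightarrow> finite F \<longrightarrow>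
     (\<forall>k\<in>F. D / 2 < norm (freq_vec k)) \<longrightarrow>
     sum (triangle_box_coeff r) F \<le> C * (\<rho> powr (-1/4) * D powr (-1/8))"
proof -
  obtain C0 where C0: "C0 > 0" and tail: "\<And>r T F. 0 < r \<Longrightarrow> 0 < T \<Longrightarrow> finite F \<Longrightarrow>
      (\<And>k. k \<in> F \<Longrightarrow> T < \<bar>real_of_int k\<bar>) \<Longrightarrow>
      sum (triangle_coeff r) F \<le> C0 * (r powr (-1/4) * T powr (-1/8))"
    using triangle_coeff_tail_le by metis
  define d where "d = real CARD('n)"
  have d: "d \<ge> 1" by (simp add: d_def Suc_le_eq)
  show ?thesis
  proof (intro exI[of _ "d * (C0 * (1 / (2 * sqrt d)) powr (-1/8))"] conjI allI impI)
    show "d * (C0 * (1 / (2 * sqrt d)) powr (-1/8)) > 0" using d C0 by simp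
    fix r :: "'n \<Rightarrow> real" and \<rho> D :: real and F :: "('n \<Rightarrow> int) set"
    assume r: "\<forall>i. 0 < r i \<and> r i \<le> 1/2 \<and> \<rho> \<le> r i" and \<rho>: "0 < \<rho>" and D: "0 < D" and F: "finite F"
      and big: "\<forall>k\<in>F. D / 2 < norm (freq_vec k)"
    define T where "T = D * (1 / (2 * sqrt d))"
    have T: "T > 0" using D d by (simp add: T_def)
    have "(\<Sum>k\<in>F. \<Prod>i\<in>UNIV. triangle_coeff (r i) (k i))
        \<le> real CARD('n) * (C0 * (\<rho> powr (-1/4) * T powr (-1/8))) * 1 ^ CARD('n)"
    proof (rule sum_prod_restricted_le[where P = "\<lambda>j. T < \<bar>real_of_int j\<bar>"])
      fix k assume k: "k \<in> F"
      show "\<exists>i. T < \<bar>real_of_int (k i)\<bar>"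
      proof (rule ccontr)
        assume "\<not> ?thesis"
        then have "norm (freq_vec k) \<le> sqrt d * T"
          unfolding d_def using T by (intro norm_vec_le_of_components) (auto simp: freq_vec_def not_less)
        also have "\<dots> = D / 2" using d by (simp add: T_def)
        finally show False using big k by force
      qed
    next
      fix i and G :: "int set" assume G: "finite G" "\<And>j. j \<in> G \<Longrightarrow> T < \<bar>real_of_int j\<bar>"
      have "sum (triangle_coeff (r i)) G \<le> C0 * (r i powr (-1/4) * T powr (-1/8))"
        using r by (intro tail T G) auto
      also have "\<dots> \<le> C0 * (\<rho> powr (-1/4) * T powr (-1/8))"
        using C0 r \<rho> by (intro mult_left_mono mult_right_mono powr_mono2') auto
      finally show "sum (triangle_coeff (r i)) G \<le> C0 * (\<rho> powr (-1/4) * T powr (-1/8))" .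
    qed (use F r triangle_coeff_nonneg triangle_coeff_sum_le_1 in auto)
    also have "T powr (-1/8) = D powr (-1/8) * (1 / (2 * sqrt d)) powr (-1/8)"
      unfolding T_def by (rule powr_mult)
    finally show "sum (triangle_box_coeff r) F \<le> d * (C0 * (1 / (2 * sqrt d)) powr (-1/8)) * (\<rho> powr (-1/4) * D powr (-1/8))"
      by (simp add: box_coeff_def d_def mult_ac)
  qed
qed

text \<open>
  For D < 3/2 there is nothing to gain: every l is met by at most one k, whose coefficient is at most
  the volume of the first box, and the coefficients of l sum to at most 1.

  For D \<ge> 3/2 cover the frequencies k by cubes of side h = D / (3 sqrt d), whose diameter is D/3.
  Two occurring k in one cube have companions V l, V l' at distance less than 1 + D/3 \<le> D, so
  l = l' and then k = k'. As l is nonzero, |k| > D - 1/2 \<ge> 2 h sqrt d, so the cube of k has an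
  index of absolute value at least 2. Hence the coefficients of the occurring k are bounded by
  a sum over distinct outer cubes, and this sum is O(1/h) = O(1/D).
\<close>
lemma near_coincidence_sum:
  fixes r r' :: "'n::finite \<Rightarrow> real"
  defines "d \<equiv> real CARD('n)"
  assumes r: "\<And>i. 0 < r i" "\<And>i. r i \<le> 1/2" and r': "\<And>i. 0 < r' i" "\<And>i. r' i \<le> 1/2"
    and D: "1 \<le> D" and V: "linear V" "\<And>x. D * norm x \<le> norm (V x)"
    and F: "finite F" "finite G" "\<And>l. l \<in> G \<Longrightarrow> l \<noteq> (\<lambda>_. 0)"
  shows "(\<Sum>k\<in>F. \<Sum>l\<in>G. triangle_box_coeff r k * triangle_box_coeff r' l *
            of_bool (norm (freq_vec k - V (freq_vec l)) < 1/2))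
          \<le> (2 + d * (6 * pi * sqrt d) * (3 + 6 * pi * sqrt d) ^ CARD('n))
             * (((\<Prod>i\<in>UNIV. r i) + (\<Prod>i\<in>UNIV. r' i)) / D)" (is "?S \<le> (2 + ?C) * ?p")
proof -
  define a where "a = triangle_box_coeff r"
  define a' where "a' = triangle_box_coeff r'"
  define near where "near k l \<longleftrightarrow> norm (freq_vec k - V (freq_vec l)) < 1/2" for k l
  have a0: "0 \<le> a k" "a k \<le> (\<Prod>i\<in>UNIV. r i)" for k
    unfolding a_def using r by (simp_all add: triangle_box_coeff_nonneg triangle_box_coeff_le)
  have a'0: "0 \<le> a' k" "a' k \<le> (\<Prod>i\<in>UNIV. r' i)" for k
    unfolding a'_def using r' by (simp_all add: triangle_box_coeff_nonneg triangle_box_coeff_le)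
  have p0: "0 \<le> (\<Prod>i\<in>UNIV. r i)" "0 \<le> (\<Prod>i\<in>UNIV. r' i)"
    using r r' by (auto intro!: prod_nonneg simp: less_imp_le)
  have d1: "d \<ge> 1" by (simp add: d_def Suc_le_eq)
  have single: "sum f X \<le> B" if X: "finite X" "\<And>x y. x \<in> X \<Longrightarrow> y \<in> X \<Longrightarrow> x = y" "\<And>x. f x \<le> B" "0 \<le> B"
    for f :: "('n \<Rightarrow> int) \<Rightarrow> real" and X B
  proof (cases "X = {}")
    case False
    then obtain x where "X = {x}" using X(2) by blast
    then show ?thesis using X by simp
  qed (use X in simp)
  have S: "?S = (\<Sum>k\<in>F. \<Sum>l\<in>G. a k * a' l * of_bool (near k l))" by (simp add: a_def a'_def near_def)
  have "?C \<ge> 0" using d1 by simp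
  show ?thesis
  proof (cases "D < 3/2")
    case True
    have "?S = (\<Sum>l\<in>G. \<Sum>k\<in>F. a k * a' l * of_bool (near k l))" unfolding S by (rule sum.swap)
    also have "\<dots> = (\<Sum>l\<in>G. a' l * (\<Sum>k\<in>{k\<in>F. near k l}. a k))"
      using F by (simp add: sum_distrib_left sum.inter_filter of_bool_def if_distrib mult.commute cong: if_cong)
    also have "\<dots> \<le> (\<Sum>l\<in>G. a' l * (\<Prod>i\<in>UNIV. r i))"
    proof (intro sum_mono mult_left_mono single a0 a'0 p0)
      fix l k k' assume k: "k \<in> {k\<in>F. near k l}" "k' \<in> {k\<in>F. near k l}"
      have "norm (freq_vec k - freq_vec k') < 1/2 + 1/2"
        using k norm_triangle_lt[of "freq_vec k - V (freq_vec l)" "V (freq_vec l) - freq_vec k'" 1]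
        by (auto simp: near_def norm_minus_commute)
      then show "k = k'" using freq_vec_diff_ge_1[of k k'] by force
    qed (use F in auto)
    also have "\<dots> = (\<Sum>l\<in>G. a' l) * (\<Prod>i\<in>UNIV. r i)" by (simp add: sum_distrib_right)
    also have "\<dots> \<le> 1 * (\<Prod>i\<in>UNIV. r i)"
      unfolding a'_def using p0 r' F by (intro mult_right_mono triangle_box_coeff_sum_le_1) auto
    also have "\<dots> \<le> 2 * ?p"
    proof -
      have "(\<Prod>i\<in>UNIV. r i) * D \<le> (\<Prod>i\<in>UNIV. r i) * 2"
        using True p0 by (intro mult_left_mono) auto
      also have "\<dots> \<le> 2 * ((\<Prod>i\<in>UNIV. r i) + (\<Prod>i\<in>UNIV. r' i))" using p0 by simp
      finally show ?thesis using D by (simp add: pos_le_divide_eq)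
    qed
    also have "\<dots> \<le> (2 + ?C) * ?p"
      using \<open>?C \<ge> 0\<close> p0 D by (intro mult_right_mono) auto
    finally show ?thesis .
  next
    case False
    \<comment> \<open>The side length is chosen so that the cubes have diameter D / 3.\<close>
    define h where "h = D / (3 * sqrt d)"
    have h: "h > 0" using D d1 by (simp add: h_def)
    have hd: "sqrt d * h = D / 3" using d1 by (simp add: h_def)
    define cell where "cell k = (\<lambda>i. \<lfloor>real_of_int (k i) / h\<rfloor>)" for k :: "'n \<Rightarrow> int"
    define N where "N = {k\<in>F. \<exists>l\<in>G. near k l}"
    have sep: "l = l'" if "near k l" "near k' l'" "norm (freq_vec k - freq_vec k') \<le> D / 3" for k k' l l'
    proof (rule ccontr)
      assume "l \<noteq> l'"
      have "D * 1 \<le> D * norm (freq_vec l - freq_vec l')"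
        using freq_vec_diff_ge_1[OF \<open>l \<noteq> l'\<close>] D by (intro mult_left_mono) auto
      also have "\<dots> \<le> norm (V (freq_vec l) - V (freq_vec l'))"
        using V(2)[of "freq_vec l - freq_vec l'"] by (simp add: linear_diff[OF V(1)])
      also have "\<dots> = norm ((freq_vec k' - V (freq_vec l')) - (freq_vec k - V (freq_vec l)) + (freq_vec k - freq_vec k'))"
        by simp
      also have "\<dots> \<le> norm (freq_vec k' - V (freq_vec l')) + norm (freq_vec k - V (freq_vec l)) + norm (freq_vec k - freq_vec k')"
        by (intro norm_triangle_le add_mono norm_triangle_ineq4 order_refl)
      also have "\<dots> < 1 + D / 3" using that by (simp add: near_def)
      finally show False using False by simp
    qed
    have inj: "inj_on cell N"
    proof (rule inj_onI)
      fix k k' assume k: "k \<in> N" "k' \<in> N" and eq: "cell k = cell k'"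
      have "\<bar>real_of_int (k i) - real_of_int (k' i)\<bar> \<le> h" for i
      proof -
        have "\<lfloor>real_of_int (k i) / h\<rfloor> = \<lfloor>real_of_int (k' i) / h\<rfloor>" using eq by (simp add: cell_def fun_eq_iff)
        then have "\<bar>real_of_int (k i) / h - real_of_int (k' i) / h\<bar> \<le> 1" by linarith
        then show ?thesis using h by (simp add: diff_divide_distrib[symmetric] abs_divide)
      qed
      then have "norm (freq_vec k - freq_vec k') \<le> sqrt d * h"
        unfolding d_def using h by (intro norm_vec_le_of_components) (auto simp: freq_vec_def)
      then have close: "norm (freq_vec k - freq_vec k') \<le> D / 3" by (simp add: hd)
      obtain l l' where l: "near k l" "near k' l'" using k by (auto simp: N_def)
      have "l = l'" using sep[OF l close] .
      then have "norm (freq_vec k - freq_vec k') < 1/2 + 1/2"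
        using l norm_triangle_lt[of "freq_vec k - V (freq_vec l)" "V (freq_vec l) - freq_vec k'" 1]
        by (auto simp: near_def norm_minus_commute)
      then show "k = k'" using freq_vec_diff_ge_1[of k k'] by force
    qed
    have outer: "\<exists>i. 2 \<le> \<bar>cell k i\<bar>" if kN: "k \<in> N" for k
    proof (rule ccontr)
      assume "\<not> ?thesis"
      then have c: "\<bar>cell k i\<bar> \<le> 1" for i by (metis not_le zless_add1_eq one_add_one order_le_less)
      have "\<bar>real_of_int (k i)\<bar> \<le> 2 * h" for i
      proof -
        have "\<bar>real_of_int (k i) / h\<bar> \<le> 2" using c[of i] unfolding cell_def by linarith
        then show ?thesis using h by (simp add: abs_divide divide_le_eq)
      qed
      then have "norm (freq_vec k) \<le> sqrt d * (2 * h)"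
        unfolding d_def using h by (intro norm_vec_le_of_components) (auto simp: freq_vec_def)
      then have 1: "norm (freq_vec k) \<le> 2 * D / 3" using hd by simp
      obtain l where l: "l \<in> G" "near k l" using kN by (auto simp: N_def)
      have "D * 1 \<le> D * norm (freq_vec l)"
        using freq_vec_ge_1 F(3)[OF l(1)] D by (intro mult_left_mono) auto
      also have "\<dots> \<le> norm (V (freq_vec l))" by (rule V)
      also have "\<dots> \<le> norm (freq_vec k) + norm (freq_vec k - V (freq_vec l))"
        by (metis norm_triangle_sub norm_minus_commute)
      also have "\<dots> < norm (freq_vec k) + 1/2" using l by (simp add: near_def)
      finally show False using 1 False by simp
    qed
    have "?S = (\<Sum>k\<in>F. a k * (\<Sum>l\<in>{l\<in>G. near k l}. a' l))"
      unfolding S using F by (simp add: sum_distrib_left sum.inter_filter of_bool_def if_distrib mult.commute cong: if_cong)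
    also have "\<dots> = (\<Sum>k\<in>N. a k * (\<Sum>l\<in>{l\<in>G. near k l}. a' l))"
    proof (rule sum.mono_neutral_right)
      show "\<forall>k\<in>F - N. a k * (\<Sum>l\<in>{l\<in>G. near k l}. a' l) = 0"
      proof
        fix k assume "k \<in> F - N"
        then have e: "{l\<in>G. near k l} = {}" by (auto simp: N_def)
        show "a k * (\<Sum>l\<in>{l\<in>G. near k l}. a' l) = 0" by (simp only: e sum.empty mult_zero_right)
      qed
    qed (use F in \<open>auto simp: N_def\<close>)
    also have "\<dots> \<le> (\<Sum>k\<in>N. a k * (\<Prod>i\<in>UNIV. r' i))"
    proof (intro sum_mono mult_left_mono single a0 a'0 p0)
      fix k l l' assume "l \<in> {l\<in>G. near k l}" "l' \<in> {l\<in>G. near k l}"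
      then show "l = l'" using sep[of k l k l'] D by simp
    qed (use F in auto)
    also have "\<dots> = (\<Sum>k\<in>N. a k) * (\<Prod>i\<in>UNIV. r' i)" by (simp add: sum_distrib_right)
    also have "\<dots> \<le> (?C / D) * (\<Prod>i\<in>UNIV. r' i)"
    proof (rule mult_right_mono[OF _ p0(2)])
      have "(\<Sum>k\<in>N. a k) \<le> (\<Sum>k\<in>N. \<Prod>i\<in>UNIV. Lorentz_cell (r i) h (cell k i))"
        unfolding a_def box_coeff_def cell_def
        using r h by (intro sum_mono prod_mono) (auto simp: triangle_coeff_nonneg triangle_coeff_le_Lorentz_cell)
      also have "\<dots> = (\<Sum>q\<in>cell ` N. \<Prod>i\<in>UNIV. Lorentz_cell (r i) h (q i))"
        using inj by (simp add: sum.reindex)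
      also have "\<dots> \<le> real CARD('n) * (6 * pi * sqrt d / D) * (3 + 6 * pi * sqrt d) ^ CARD('n)"
      proof (rule sum_prod_restricted_le[where P = "\<lambda>j. 2 \<le> \<bar>j\<bar>"])
        have ph: "2 * pi / h = 6 * pi * sqrt d / D" by (simp add: h_def)
        show "finite (cell ` N)" using F by (simp add: N_def)
        show "\<exists>i. 2 \<le> \<bar>q i\<bar>" if "q \<in> cell ` N" for q using that outer by auto
        show "0 \<le> Lorentz_cell (r i) h j" for i j using r by (simp add: Lorentz_cell_nonneg)
        show "sum (Lorentz_cell (r i) h) X \<le> 6 * pi * sqrt d / D" if "finite X" "\<And>j. j \<in> X \<Longrightarrow> 2 \<le> \<bar>j\<bar>" for i X
          using Lorentz_cell_outer_sum_le[OF r(1) h that] by (simp add: ph)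
        show "sum (Lorentz_cell (r i) h) X \<le> 3 + 6 * pi * sqrt d" if "finite X" for i X
        proof -
          have "6 * pi * sqrt d / D \<le> 6 * pi * sqrt d / 1" using D d1 by (intro divide_left_mono) auto
          then show ?thesis using Lorentz_cell_sum_le[OF r(1) h that, of i] r(2)[of i] by (simp add: ph)
        qed
        show "1 \<le> 3 + 6 * pi * sqrt d" using d1 by (simp add: add_increasing2)
      qed
      also have "\<dots> = ?C / D" by (simp add: d_def)
      finally show "(\<Sum>k\<in>N. a k) \<le> ?C / D" .
    qed
    also have "\<dots> \<le> ?C * ?p"
    proof -
      have "(\<Prod>i\<in>UNIV. r' i) / D \<le> ?p" using p0 D by (intro divide_right_mono) auto
      then have "?C * ((\<Prod>i\<in>UNIV. r' i) / D) \<le> ?C * ?p" using \<open>?C \<ge> 0\<close> by (rule mult_left_mono)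
      then show ?thesis by simp
    qed
    also have "\<dots> \<le> (2 + ?C) * ?p"
      using p0 D by (intro mult_right_mono) auto
    finally show ?thesis .
  qed
qed

context lacunary_matrices
begin

text \<open>
  The function \<phi> stands for the modulus of the Fourier coefficient of the measure, dm and dn for its
  bounds at the scales of m and n. The three terms on the right belong to the three kinds of pairs:
  z = k - ratio m n l short, z long with k short, and z long with k long. The constant must not
  depend on the radii, the indices or the truncation M.
\<close>
lemma pair_correlation:
  obtains C where "C > 0" "\<And>m n (r :: 'n \<Rightarrow> real) r' \<rho> c \<phi> dm dn M. 1 \<le> m \<Longrightarrow> m \<le> n \<Longrightarrow>
     (\<forall>i. 0 < r i \<and> r i \<le> 1/2 \<and> \<rho> \<le> r i) \<Longrightarrow> (\<forall>i. 0 < r' i \<and> r' i \<le> 1/2) \<Longrightarrow> 0 < \<rho> \<Longrightarrow> 0 < c \<Longrightarrow>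
     (\<forall>x. c * K ^ m * norm x \<le> norm (transpose (A m) *v x)) \<Longrightarrow>
     (\<forall>t. \<phi> t \<le> 1) \<Longrightarrow> 0 \<le> dm \<Longrightarrow> 0 \<le> dn \<Longrightarrow>
     (\<forall>t. c / 2 * K ^ m \<le> norm t \<longrightarrow> \<phi> t \<le> dm) \<Longrightarrow> (\<forall>t. c / 2 * K ^ n \<le> norm t \<longrightarrow> \<phi> t \<le> dn) \<Longrightarrow>
     (\<Sum>k\<in>freq_box M - {\<lambda>_. 0}. \<Sum>l\<in>freq_box M - {\<lambda>_. 0}.
        triangle_box_coeff r k * triangle_box_coeff r' l * \<phi> (transpose (A m) *v freq_vec k - transpose (A n) *v freq_vec l))
     \<le> C * (((\<Prod>i\<in>UNIV. r i) + (\<Prod>i\<in>UNIV. r' i)) / K ^ (n - m) + dn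
              + dm * (\<rho> powr (-1/4) * (K ^ (n - m)) powr (-1/8)))"
proof -
  define d where "d = real CARD('n)"
  define C1 where "C1 = 2 + d * (6 * pi * sqrt d) * (3 + 6 * pi * sqrt d) ^ CARD('n)"
  have C1: "C1 \<ge> 2" by (simp add: C1_def d_def)
  obtain C2 where C2: "C2 > 0" and tail: "\<And>(r :: 'n \<Rightarrow> real) \<rho> D F.
     (\<forall>i. 0 < r i \<and> r i \<le> 1/2 \<and> \<rho> \<le> r i) \<Longrightarrow> 0 < \<rho> \<Longrightarrow> 0 < D \<Longrightarrow> finite F \<Longrightarrow>
     (\<forall>k\<in>F. D / 2 < norm (freq_vec k)) \<Longrightarrow>
     sum (triangle_box_coeff r) F \<le> C2 * (\<rho> powr (-1/4) * D powr (-1/8))"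
    using triangle_box_coeff_tail[where 'n = 'n] by metis
  show ?thesis
  proof (rule that[of "C1 + C2 + 1"])
    fix m n :: nat and r r' :: "'n \<Rightarrow> real" and \<rho> c dm dn :: real and \<phi> :: "real ^ 'n \<Rightarrow> real" and M :: nat
    assume mn: "1 \<le> m" "m \<le> n"
      and r: "\<forall>i. 0 < r i \<and> r i \<le> 1/2 \<and> \<rho> \<le> r i" and r': "\<forall>i. 0 < r' i \<and> r' i \<le> 1/2"
      and \<rho>: "0 < \<rho>" and c: "0 < c" and Am: "\<forall>x. c * K ^ m * norm x \<le> norm (transpose (A m) *v x)"
      and \<phi>: "\<forall>t. \<phi> t \<le> 1" and dm: "0 \<le> dm" and dn: "0 \<le> dn"
      and \<phi>m: "\<forall>t. c / 2 * K ^ m \<le> norm t \<longrightarrow> \<phi> t \<le> dm" and \<phi>n: "\<forall>t. c / 2 * K ^ n \<le> norm t \<longrightarrow> \<phi> t \<le> dn"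
    define a where "a = triangle_box_coeff r"
    define a' where "a' = triangle_box_coeff r'"
    define X where "X = freq_box M - {\<lambda>_::'n. 0::int}"
    define D where "D = K ^ (n - m)"
    have D: "D \<ge> 1" using K1 by (simp add: D_def)
    have KD: "K ^ m * D = K ^ n" using mn by (simp add: D_def flip: power_add)
    define V where "V = (*v) (ratio m n)"
    have V: "linear V" "\<And>x. D * norm x \<le> norm (V x)"
      using ratio_expands[OF mn] by (simp_all add: V_def D_def)
    have fin: "finite X" by (simp add: X_def)
    have a0: "0 \<le> a k" for k unfolding a_def using r by (simp add: triangle_box_coeff_nonneg)
    have a'0: "0 \<le> a' k" for k unfolding a'_def using r' by (simp add: triangle_box_coeff_nonneg)
    have as: "sum a Y \<le> 1" if "finite Y" for Y unfolding a_def using r that by (simp add: triangle_box_coeff_sum_le_1)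
    have a's: "sum a' Y \<le> 1" if "finite Y" for Y unfolding a'_def using r' that by (simp add: triangle_box_coeff_sum_le_1)
    have \<phi>le: "\<phi> (transpose (A m) *v freq_vec k - transpose (A n) *v freq_vec l)
        \<le> of_bool (norm (freq_vec k - V (freq_vec l)) < 1/2) + (dn + dm * of_bool (D / 2 < norm (freq_vec k)))"
      if l: "l \<in> X" for k l
    proof -
      define z where "z = freq_vec k - V (freq_vec l)"
      define t where "t = transpose (A m) *v freq_vec k - transpose (A n) *v freq_vec l"
      have t: "t = transpose (A m) *v z"
        unfolding t_def z_def V_def transpose_factor[OF mn(1), of n] by (simp add: matrix_vector_mult_diff_distrib)
      have tz: "c * K ^ m * norm z \<le> norm t" using Am by (simp add: t)
      have "\<phi> t \<le> of_bool (norm z < 1/2) + (dn + dm * of_bool (D / 2 < norm (freq_vec k)))"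
      proof (cases "norm z < 1/2")
        case True
        have "0 \<le> dn + dm * of_bool (D / 2 < norm (freq_vec k))" using dn dm by simp
        then show ?thesis using True \<phi> by (smt (verit) of_bool_eq_1_iff)
      next
        case far: False
        show ?thesis
        proof (cases "D / 2 < norm (freq_vec k)")
          case True
          have "c * K ^ m * (1/2) \<le> c * K ^ m * norm z" using far c K1 by (intro mult_left_mono) auto
          then have "\<phi> t \<le> dm" using tz \<phi>m by simp
          then show ?thesis using True far dn by simp
        next
          case False
          have "D * 1 \<le> D * norm (freq_vec l)"
            using freq_vec_ge_1[of l] l D by (intro mult_left_mono) (auto simp: X_def)
          also have "\<dots> \<le> norm (V (freq_vec l))" by (rule V)
          also have "\<dots> \<le> norm (freq_vec k) + norm z"
            unfolding z_def by (metis norm_triangle_sub norm_minus_commute)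
          finally have "D / 2 \<le> norm z" using False by simp
          then have "c * K ^ m * (D / 2) \<le> c * K ^ m * norm z" using c K1 by (intro mult_left_mono) auto
          also have "c * K ^ m * (D / 2) = c / 2 * K ^ n" using KD by (simp add: mult.assoc)
          finally have "\<phi> t \<le> dn" using tz \<phi>n by simp
          then show ?thesis using False far by simp
        qed
      qed
      then show ?thesis by (simp add: z_def t_def)
    qed
    have "(\<Sum>k\<in>X. \<Sum>l\<in>X. a k * a' l * \<phi> (transpose (A m) *v freq_vec k - transpose (A n) *v freq_vec l))
        \<le> (\<Sum>k\<in>X. \<Sum>l\<in>X. a k * a' l * (of_bool (norm (freq_vec k - V (freq_vec l)) < 1/2)
              + (dn + dm * of_bool (D / 2 < norm (freq_vec k)))))"
      using a0 a'0 \<phi>le by (intro sum_mono mult_left_mono) auto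
    also have "\<dots> = (\<Sum>k\<in>X. \<Sum>l\<in>X. a k * a' l * of_bool (norm (freq_vec k - V (freq_vec l)) < 1/2))
        + (\<Sum>k\<in>X. a k * (dn + dm * of_bool (D / 2 < norm (freq_vec k)))) * sum a' X"
      by (simp add: sum.distrib distrib_left sum_distrib_left sum_distrib_right mult_ac)
    also have "\<dots> \<le> C1 * (((\<Prod>i\<in>UNIV. r i) + (\<Prod>i\<in>UNIV. r' i)) / D)
        + (dn + dm * (C2 * (\<rho> powr (-1/4) * D powr (-1/8)))) * 1"
    proof (intro add_mono mult_mono)
      show "(\<Sum>k\<in>X. \<Sum>l\<in>X. a k * a' l * of_bool (norm (freq_vec k - V (freq_vec l)) < 1/2))
          \<le> C1 * (((\<Prod>i\<in>UNIV. r i) + (\<Prod>i\<in>UNIV. r' i)) / D)"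
        unfolding a_def a'_def C1_def d_def
        by (rule near_coincidence_sum) (use r r' D V fin in \<open>auto simp: X_def\<close>)
      have "(\<Sum>k\<in>X. a k * (dn + dm * of_bool (D / 2 < norm (freq_vec k))))
          = dn * sum a X + dm * sum a {k\<in>X. D / 2 < norm (freq_vec k)}"
      proof -
        have "sum a {k\<in>X. D / 2 < norm (freq_vec k)} = (\<Sum>k\<in>X. a k * of_bool (D / 2 < norm (freq_vec k)))"
          by (simp only: sum.inter_filter[OF fin]) (auto intro!: sum.cong)
        then show ?thesis
          by (simp only: sum_distrib_left sum.distrib[symmetric]) (auto intro!: sum.cong simp: algebra_simps)
      qed
      also have "\<dots> \<le> dn * 1 + dm * (C2 * (\<rho> powr (-1/4) * D powr (-1/8)))"
        unfolding a_def using r \<rho> D fin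
        by (intro add_mono mult_left_mono dn dm tail as[unfolded a_def]) auto
      finally show "(\<Sum>k\<in>X. a k * (dn + dm * of_bool (D / 2 < norm (freq_vec k))))
          \<le> dn + dm * (C2 * (\<rho> powr (-1/4) * D powr (-1/8)))" by simp
      show "0 \<le> dn + dm * (C2 * (\<rho> powr (-1/4) * D powr (-1/8)))" using dn dm C2 by simp
    qed (use a's fin a'0 in \<open>auto intro: sum_nonneg\<close>)
    also have "\<dots> \<le> (C1 + C2 + 1) * (((\<Prod>i\<in>UNIV. r i) + (\<Prod>i\<in>UNIV. r' i)) / D)
        + ((C1 + C2 + 1) * dn + (C1 + C2 + 1) * (dm * (\<rho> powr (-1/4) * D powr (-1/8))))"
    proof -
      have "0 \<le> ((\<Prod>i\<in>UNIV. r i) + (\<Prod>i\<in>UNIV. r' i)) / D"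
        using r r' D by (intro divide_nonneg_nonneg add_nonneg_nonneg prod_nonneg) (auto intro: less_imp_le)
      then have "C1 * (((\<Prod>i\<in>UNIV. r i) + (\<Prod>i\<in>UNIV. r' i)) / D)
          \<le> (C1 + C2 + 1) * (((\<Prod>i\<in>UNIV. r i) + (\<Prod>i\<in>UNIV. r' i)) / D)"
        using C2 by (intro mult_right_mono) auto
      moreover have "1 * dn \<le> (C1 + C2 + 1) * dn" using C1 C2 dn by (intro mult_right_mono) auto
      moreover have "C2 * (dm * (\<rho> powr (-1/4) * D powr (-1/8))) \<le> (C1 + C2 + 1) * (dm * (\<rho> powr (-1/4) * D powr (-1/8)))"
        using C1 dm by (intro mult_right_mono) auto
      ultimately show ?thesis by (simp add: mult.left_commute)
    qed
    finally show "(\<Sum>k\<in>freq_box M - {\<lambda>_. 0}. \<Sum>l\<in>freq_box M - {\<lambda>_. 0}.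
        triangle_box_coeff r k * triangle_box_coeff r' l * \<phi> (transpose (A m) *v freq_vec k - transpose (A n) *v freq_vec l))
     \<le> (C1 + C2 + 1) * (((\<Prod>i\<in>UNIV. r i) + (\<Prod>i\<in>UNIV. r' i)) / K ^ (n - m) + dn
              + dm * (\<rho> powr (-1/4) * (K ^ (n - m)) powr (-1/8)))"
      by (simp add: distrib_left X_def a_def a'_def D_def)
  qed (use C1 C2 in simp)
qed

end

section \<open>Measures on the torus and their Fourier coefficients\<close>

lemma dist_int_add_of_int: "dist_int (a + of_int m) = dist_int a"
proof -
  have "round (a + of_int m) = round a + m" unfolding round_def by linarith
  then show ?thesis by (simp add: dist_int_eq_round)
qed

lemma dist_int_add_Ints: "m \<in> \<int> \<Longrightarrow> dist_int (a + m) = dist_int a"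
  by (auto elim!: Ints_cases simp: dist_int_add_of_int)

lemma dist_int_nonneg: "0 \<le> dist_int a"
  by (simp add: dist_int_eq_round)

lemma dist_int_measurable [measurable]: "dist_int \<in> borel_measurable borel"
  unfolding dist_int_eq_round[abs_def] round_def by measurable

lemma mod_one_eq_iff: "mod_one x = mod_one z \<longleftrightarrow> (\<forall>i. x $ i - z $ i \<in> \<int>)"
proof -
  have "frac a = frac b \<longleftrightarrow> a - b \<in> \<int>" for a b :: real
  proof
    assume "frac a = frac b"
    then have "a - b = of_int (\<lfloor>a\<rfloor> - \<lfloor>b\<rfloor>)" by (simp add: frac_def)
    then show "a - b \<in> \<int>" by (metis Ints_of_int)
  next
    assume "a - b \<in> \<int>"
    then obtain m where "a = b + of_int m" by (metis Ints_cases add.commute diff_add_cancel)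
    then show "frac a = frac b" by (simp add: frac_def)
  qed
  then show ?thesis by (simp add: mod_one_def vec_eq_iff)
qed

lemma hits_target_box_iff:
  "mod_one u \<in> mod_one ` ((\<lambda>z. y + z) ` target_box r n) \<longleftrightarrow> (\<forall>i. dist_int ((u - y) $ i) \<le> r i n)"
proof
  assume "mod_one u \<in> mod_one ` ((\<lambda>z. y + z) ` target_box r n)"
  then obtain z where z: "z \<in> target_box r n" "mod_one u = mod_one (y + z)" by auto
  show "\<forall>i. dist_int ((u - y) $ i) \<le> r i n"
  proof
    fix i
    have "u $ i - (y $ i + z $ i) \<in> \<int>" using z(2) by (simp add: mod_one_eq_iff)
    then have "dist_int (z $ i + (u $ i - (y $ i + z $ i))) = dist_int (z $ i)" by (rule dist_int_add_Ints)
    then show "dist_int ((u - y) $ i) \<le> r i n" using z(1) by (simp add: target_box_def algebra_simps)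
  qed
next
  assume *: "\<forall>i. dist_int ((u - y) $ i) \<le> r i n"
  define z where "z = mod_one (u - y)"
  have fl: "z $ i = (u - y) $ i + of_int (- \<lfloor>(u - y) $ i\<rfloor>)" for i by (simp add: z_def mod_one_def frac_def)
  have "dist_int (z $ i) \<le> r i n" for i
    using * by (simp only: fl dist_int_add_of_int)
  then have "z \<in> target_box r n"
    using mod_one_in_unit_cube[of "u - y"] unfolding target_box_def by (auto simp flip: z_def)
  moreover have "mod_one u = mod_one (y + z)"
    unfolding mod_one_eq_iff by (simp add: fl)
  ultimately show "mod_one u \<in> mod_one ` ((\<lambda>z. y + z) ` target_box r n)" by blast
qed

locale torus_prob = prob_space \<mu> for \<mu> :: "(real ^ 'n::finite) measure" +
  assumes sets_mu: "sets \<mu> = sets torus_borel"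
begin

lemma space_mu: "space \<mu> = unit_cube"
  using sets_eq_imp_space_eq[OF sets_mu] by (simp add: space_torus_borel)

lemma borel_measurable_mu: "f \<in> measurable borel N \<Longrightarrow> f \<in> measurable \<mu> N"
  using measurable_restrict_space1[of f borel N unit_cube] measurable_cong_sets[OF sets_mu refl, of N]
    measurable_cong_sets[OF sets_torus_borel refl, of N] by (metis (no_types, lifting))

text \<open>
  The complement of the support is a union of open null sets. Their preimages under the reduction
  modulo 1 are open in Euclidean space, so countably many of them suffice.
\<close>
lemma null_outside_support: "unit_cube - measure_support torus \<mu> \<in> null_sets \<mu>"
proof -
  define \<U> where "\<U> = {U. openin torus U \<and> emeasure \<mu> U = 0}"
  have un: "unit_cube - measure_support torus \<mu> = \<Union>\<U>"
    unfolding \<U>_def measure_support_def topspace_torus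
    using openin_subset[of torus] by (auto simp: topspace_torus not_gr_zero)
  have "\<And>S. S \<in> (\<lambda>U. mod_one -` U) ` \<U> \<Longrightarrow> open (S :: (real ^ 'n) set)"
    by (auto simp: \<U>_def openin_torus)
  from Lindelof[OF this] obtain \<F> where F: "\<F> \<subseteq> (\<lambda>U. mod_one -` U) ` \<U>" "countable \<F>" "\<Union>\<F> = \<Union>((\<lambda>U. mod_one -` U) ` \<U>)"
    by metis
  obtain \<V> where V: "\<V> \<subseteq> \<U>" "countable \<V>" "\<F> = (\<lambda>U. mod_one -` U) ` \<V>"
    using F(1,2) by (metis countable_subset_image)
  have "\<Union>\<U> = \<Union>\<V>"
  proof
    show "\<Union>\<U> \<subseteq> \<Union>\<V>"
    proof
      fix x assume x: "x \<in> \<Union>\<U>"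
      then have m: "mod_one x = x" by (auto simp: \<U>_def openin_torus mod_one_id subset_iff)
      then have "x \<in> \<Union>((\<lambda>U. mod_one -` U) ` \<U>)" using x by auto
      then have "x \<in> \<Union>((\<lambda>U. mod_one -` U) ` \<V>)" using F(3) V(3) by simp
      then obtain U where "U \<in> \<V>" "mod_one x \<in> U" by blast
      then show "x \<in> \<Union>\<V>" unfolding m by blast
    qed
  qed (use V in auto)
  moreover have "(\<Union>U\<in>\<V>. U) \<in> null_sets \<mu>"
  proof (rule null_sets_UN'[OF V(2)])
    fix U assume "U \<in> \<V>"
    then have U: "openin torus U" "emeasure \<mu> U = 0" using V by (auto simp: \<U>_def)
    have "U \<in> sets \<mu>" unfolding sets_mu torus_borel_def
      using U(1) openin_subset by (auto simp: sets_measure_of_conv intro!: sigma_sets.Basic)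
    then show "U \<in> null_sets \<mu>" using U by auto
  qed
  ultimately show ?thesis using un by auto
qed

lemma integrable_cis [simp]:
  assumes "f \<in> borel_measurable \<mu>" shows "integrable \<mu> (\<lambda>x. cis (f x))"
proof (rule integrable_const_bound[where B = 1])
  have "(\<lambda>x. cis (f x)) = (\<lambda>x. exp (\<i> * of_real (f x)))" by (simp add: cis_conv_exp)
  then show "(\<lambda>x. cis (f x)) \<in> borel_measurable \<mu>" using assms by simp
qed auto

lemma inner_measurable [measurable]: "(\<lambda>x. t \<bullet> x) \<in> borel_measurable \<mu>"
  by (rule borel_measurable_mu) measurable

lemma integral_cis: "(\<integral>x. cis (2 * pi * (t \<bullet> x)) \<partial>\<mu>) = fourier_coeff \<mu> (- t)"
  unfolding fourier_coeff_def cis_conv_exp by (intro Bochner_Integration.integral_cong refl) (simp add: mult_ac)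

lemma norm_fourier_coeff_le_1: "norm (fourier_coeff \<mu> t) \<le> 1"
proof -
  have "norm (\<integral>x. cis (2 * pi * ((-t) \<bullet> x)) \<partial>\<mu>) \<le> (\<integral>x. norm (cis (2 * pi * ((-t) \<bullet> x))) \<partial>\<mu>)"
    by (rule integral_norm_bound)
  then show ?thesis unfolding integral_cis by (simp add: prob_space)
qed

lemma norm_fourier_coeff_minus: "norm (fourier_coeff \<mu> (- t)) = norm (fourier_coeff \<mu> t)"
proof -
  have "fourier_coeff \<mu> (- t) = (\<integral>x. cnj (cis (2 * pi * ((-t) \<bullet> x))) \<partial>\<mu>)"
    by (simp add: cis_cnj flip: integral_cis)
  also have "\<dots> = cnj (\<integral>x. cis (2 * pi * ((-t) \<bullet> x)) \<partial>\<mu>)" by (rule Bochner_Integration.integral_cnj)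
  also have "\<dots> = cnj (fourier_coeff \<mu> t)" by (simp only: integral_cis minus_minus)
  finally show ?thesis by simp
qed

text \<open>
  Multiplying out the square turns each pair of frequencies into one Fourier coefficient of the
  measure; the weights are nonnegative, so the phases can be discarded.
\<close>
lemma integral_norm_square_exponential_sum:
  fixes w \<beta> :: "'j \<Rightarrow> real" and v :: "'j \<Rightarrow> real ^ 'n"
  assumes "\<And>j. j \<in> J \<Longrightarrow> 0 \<le> w j"
  shows "(\<integral>x. (norm (\<Sum>j\<in>J. of_real (w j) * cis (2 * pi * (v j \<bullet> x) + \<beta> j)))\<^sup>2 \<partial>\<mu>)
      \<le> (\<Sum>j\<in>J. \<Sum>j'\<in>J. w j * w j' * norm (fourier_coeff \<mu> (v j - v j')))"
proof -
  define Z where "Z x = (\<Sum>j\<in>J. of_real (w j) * cis (2 * pi * (v j \<bullet> x) + \<beta> j))" for x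
  define c where "c j j' = of_real (w j * w j') * cis (\<beta> j - \<beta> j')" for j j'
  have sq: "complex_of_real ((norm (Z x))\<^sup>2) = (\<Sum>j\<in>J. \<Sum>j'\<in>J. c j j' * cis (2 * pi * ((v j - v j') \<bullet> x)))" for x
  proof -
    have "complex_of_real ((norm (Z x))\<^sup>2) = Z x * cnj (Z x)" by (rule complex_norm_square)
    also have "\<dots> = (\<Sum>j\<in>J. \<Sum>j'\<in>J. (of_real (w j) * cis (2 * pi * (v j \<bullet> x) + \<beta> j)) * (of_real (w j') * cis (- (2 * pi * (v j' \<bullet> x) + \<beta> j'))))"
      by (simp add: Z_def sum_product cnj_sum cis_cnj)
    also have "\<dots> = (\<Sum>j\<in>J. \<Sum>j'\<in>J. c j j' * cis (2 * pi * ((v j - v j') \<bullet> x)))"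
    proof (intro sum.cong refl)
      fix j j'
      have "cis (2 * pi * (v j \<bullet> x) + \<beta> j) * cis (- (2 * pi * (v j' \<bullet> x) + \<beta> j')) = cis (\<beta> j - \<beta> j') * cis (2 * pi * ((v j - v j') \<bullet> x))"
        unfolding cis_mult by (rule arg_cong[where f = cis]) (simp add: inner_diff_left algebra_simps)
      then show "(of_real (w j) * cis (2 * pi * (v j \<bullet> x) + \<beta> j)) * (of_real (w j') * cis (- (2 * pi * (v j' \<bullet> x) + \<beta> j')))
          = c j j' * cis (2 * pi * ((v j - v j') \<bullet> x))"
        by (simp add: c_def mult_ac)
    qed
    finally show ?thesis .
  qed
  have "complex_of_real (\<integral>x. (norm (Z x))\<^sup>2 \<partial>\<mu>) = (\<integral>x. complex_of_real ((norm (Z x))\<^sup>2) \<partial>\<mu>)"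
    by (rule integral_complex_of_real[symmetric])
  also have "\<dots> = (\<Sum>j\<in>J. \<Sum>j'\<in>J. c j j' * (\<integral>x. cis (2 * pi * ((v j - v j') \<bullet> x)) \<partial>\<mu>))"
    unfolding sq by (simp add: Bochner_Integration.integral_sum)
  finally have "(\<integral>x. (norm (Z x))\<^sup>2 \<partial>\<mu>) = Re (\<Sum>j\<in>J. \<Sum>j'\<in>J. c j j' * fourier_coeff \<mu> (- (v j - v j')))"
    unfolding integral_cis by (metis Re_complex_of_real)
  also have "\<dots> \<le> norm (\<Sum>j\<in>J. \<Sum>j'\<in>J. c j j' * fourier_coeff \<mu> (- (v j - v j')))" by (rule complex_Re_le_cmod)
  also have "\<dots> \<le> (\<Sum>j\<in>J. \<Sum>j'\<in>J. norm (c j j' * fourier_coeff \<mu> (- (v j - v j'))))"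
    by (intro order_trans[OF norm_sum] sum_mono norm_sum)
  also have "\<dots> = (\<Sum>j\<in>J. \<Sum>j'\<in>J. w j * w j' * norm (fourier_coeff \<mu> (v j - v j')))"
    using assms by (intro sum.cong refl) (simp only: norm_mult norm_fourier_coeff_minus c_def, simp add: norm_mult)
  finally show ?thesis by (simp add: Z_def)
qed

lemma trig_poly_measurable [measurable]: "trig_poly c M \<in> borel_measurable borel"
  unfolding trig_poly_def[abs_def] cis_conv_exp by measurable

lemma phase_split: "freq_vec k \<bullet> (B *v x - y) = (transpose B *v freq_vec k) \<bullet> x - freq_vec k \<bullet> y"
proof -
  have "transpose B *v freq_vec k = freq_vec k v* B"
    using vector_transpose_matrix[of "freq_vec k" "transpose B"] by simp
  then show ?thesis by (simp only: inner_diff_right dot_lmul_matrix)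
qed

lemma zero_in_freq_box: "(\<lambda>_. 0) \<in> freq_box M"
  by (auto simp: freq_box_def PiE_iff)

lemma trig_poly_split_zero:
  fixes c :: "'n \<Rightarrow> int \<Rightarrow> real"
  shows "trig_poly c M z = of_real (box_coeff c (\<lambda>_. 0)) + (\<Sum>k\<in>freq_box M - {\<lambda>_. 0}. of_real (box_coeff c k) * cis (2 * pi * (freq_vec k \<bullet> z)))"
proof -
  have "freq_vec (\<lambda>_. 0) = (0 :: real ^ 'n)" by (simp add: freq_vec_def zero_vec_def)
  then show ?thesis unfolding trig_poly_def
    by (subst sum.remove[OF finite_freq_box zero_in_freq_box]) simp
qed

lemma trig_poly_norm_le_1:
  assumes "\<And>k. 0 \<le> box_coeff c k" "\<And>F. finite F \<Longrightarrow> sum (box_coeff c) F \<le> 1"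
  shows "norm (trig_poly c M z) \<le> 1"
proof -
  have "norm (trig_poly c M z) \<le> (\<Sum>k\<in>freq_box M. norm (of_real (box_coeff c k) * cis (2 * pi * (freq_vec k \<bullet> z))))"
    unfolding trig_poly_def by (rule norm_sum)
  also have "\<dots> = sum (box_coeff c) (freq_box M)" using assms by (simp add: norm_mult)
  also have "\<dots> \<le> 1" by (rule assms) simp
  finally show ?thesis .
qed

text \<open>
  The frequency 0 contributes its coefficient and all others together at most \<delta>, because their
  coefficients sum to at most 1.
\<close>
lemma integral_trig_poly_le:
  fixes c :: "'n \<Rightarrow> int \<Rightarrow> real"
  assumes c: "\<And>k. 0 \<le> box_coeff c k" "\<And>F. finite F \<Longrightarrow> sum (box_coeff c) F \<le> 1"
    and \<delta>: "\<And>k. k \<noteq> (\<lambda>_. 0) \<Longrightarrow> norm (fourier_coeff \<mu> (transpose B *v freq_vec k)) \<le> \<delta>" "0 \<le> \<delta>"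
  shows "norm (\<integral>x. trig_poly c M (B *v x - y) \<partial>\<mu>) \<le> box_coeff c (\<lambda>_. 0) + \<delta>"
proof -
  define X where "X = freq_box M - {\<lambda>_::'n. 0::int}"
  have "cis (2 * pi * (freq_vec k \<bullet> (B *v x - y))) = cis (- (2 * pi * (freq_vec k \<bullet> y))) * cis (2 * pi * ((transpose B *v freq_vec k) \<bullet> x))" for k x
    unfolding phase_split cis_mult by (rule arg_cong[where f = cis]) (simp add: algebra_simps)
  then have "(\<integral>x. trig_poly c M (B *v x - y) \<partial>\<mu>) = (\<integral>x. of_real (box_coeff c (\<lambda>_. 0)) +
      (\<Sum>k\<in>X. (of_real (box_coeff c k) * cis (- (2 * pi * (freq_vec k \<bullet> y)))) * cis (2 * pi * ((transpose B *v freq_vec k) \<bullet> x))) \<partial>\<mu>)"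
    unfolding trig_poly_split_zero X_def by (simp add: mult.assoc)
  also have "\<dots> = of_real (box_coeff c (\<lambda>_. 0)) +
      (\<Sum>k\<in>X. (of_real (box_coeff c k) * cis (- (2 * pi * (freq_vec k \<bullet> y)))) * fourier_coeff \<mu> (- (transpose B *v freq_vec k)))"
    by (simp add: Bochner_Integration.integral_add Bochner_Integration.integral_sum integral_cis prob_space)
  also have "norm \<dots> \<le> norm (complex_of_real (box_coeff c (\<lambda>_. 0))) +
      (\<Sum>k\<in>X. norm ((of_real (box_coeff c k) * cis (- (2 * pi * (freq_vec k \<bullet> y)))) * fourier_coeff \<mu> (- (transpose B *v freq_vec k))))"
    by (intro norm_triangle_le add_mono order_refl norm_sum)
  also have "\<dots> = box_coeff c (\<lambda>_. 0) + (\<Sum>k\<in>X. box_coeff c k * norm (fourier_coeff \<mu> (transpose B *v freq_vec k)))"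
    using c(1) by (simp only: norm_mult norm_fourier_coeff_minus) simp
  also have "\<dots> \<le> box_coeff c (\<lambda>_. 0) + (\<Sum>k\<in>X. box_coeff c k * \<delta>)"
    using c(1) \<delta> by (intro add_left_mono sum_mono mult_left_mono) (auto simp: X_def)
  also have "(\<Sum>k\<in>X. box_coeff c k * \<delta>) = sum (box_coeff c) X * \<delta>" by (simp add: sum_distrib_right)
  also have "\<dots> \<le> 1 * \<delta>" by (intro mult_right_mono c \<delta>) (simp add: X_def)
  finally show ?thesis by simp
qed

end

text \<open>
  On the scale |t| \<ge> c K^n the logarithm of |t| is at least (n/2) ln K for all large n, which turns
  logarithmic decay in t into polynomial decay in n; the finitely many remaining n are covered by
  the trivial bound 1 and a larger constant.
\<close>
lemma fourier_decay_powers: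
  fixes \<phi> :: "real ^ 'n::finite \<Rightarrow> real"
  assumes O: "\<phi> \<in> O[filtercomap infnorm at_top](\<lambda>t. ln (infnorm t) powr (- s))"
    and bd: "\<And>t. \<bar>\<phi> t\<bar> \<le> 1" and s: "0 \<le> s" and K: "1 < K" and c: "0 < c"
  shows "\<exists>C>0. \<forall>n\<ge>1. \<forall>t. c * K ^ n \<le> norm t \<longrightarrow> \<phi> t \<le> C * real n powr (- s)"
proof -
  from landau_o.bigE[OF O] obtain C0 where C0: "C0 > 0"
    and ev: "\<forall>\<^sub>F t in filtercomap infnorm at_top. norm (\<phi> t) \<le> C0 * norm (ln (infnorm t) powr (- s))" by blast
  from ev obtain T where T: "\<And>t. infnorm t \<ge> T \<Longrightarrow> norm (\<phi> t) \<le> C0 * norm (ln (infnorm t) powr (- s))"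
    unfolding eventually_filtercomap_at_top_linorder by blast
  define c' where "c' = c / sqrt (real CARD('n))"
  have c': "c' > 0" using c by (simp add: c'_def)
  have e1: "\<forall>\<^sub>F n in sequentially. max T 1 \<le> c' * K ^ n"
  proof -
    have "filterlim (\<lambda>n. c' * K ^ n) at_top sequentially"
      using c' K by real_asymp
    then show ?thesis unfolding filterlim_at_top by blast
  qed
  have e2: "\<forall>\<^sub>F n in sequentially. - ln c' \<le> real n * (ln K / 2)"
  proof -
    have "filterlim (\<lambda>n. real n * (ln K / 2)) at_top sequentially"
      by (rule filterlim_at_top_mult_tendsto_pos[OF tendsto_const _ filterlim_real_sequentially]) (use K in auto)
    then show ?thesis unfolding filterlim_at_top by blast
  qed
  obtain n0 where n0: "\<And>n. n \<ge> n0 \<Longrightarrow> max T 1 \<le> c' * K ^ n \<and> - ln c' \<le> real n * (ln K / 2)"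
    using eventually_conj[OF e1 e2] unfolding eventually_sequentially by blast
  define C where "C = C0 * (ln K / 2) powr (- s) + (real n0 + 1) powr s"
  have lK: "ln K > 0" using K by simp
  show ?thesis
  proof (intro exI[of _ C] conjI allI impI)
    show "C > 0" unfolding C_def using C0 by (intro add_nonneg_pos) auto
    fix n :: nat and t :: "real ^ 'n" assume n: "n \<ge> 1" and t: "c * K ^ n \<le> norm t"
    show "\<phi> t \<le> C * real n powr (- s)"
    proof (cases "n \<ge> n0")
      case True
      have "norm t \<le> sqrt (real CARD('n)) * infnorm t"
        using norm_le_infnorm[of t] by simp
      then have "c * K ^ n \<le> infnorm t * sqrt (real CARD('n))" using t by (simp add: mult.commute)
      then have i: "c' * K ^ n \<le> infnorm t"
        unfolding c'_def by (simp add: pos_divide_le_eq)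
      then have iT: "infnorm t \<ge> T" using n0[OF True] by simp
      have "ln (c' * K ^ n) \<le> ln (infnorm t)" using i c' K by (subst ln_le_cancel_iff) (auto intro: less_le_trans[OF _ i])
      moreover have "ln (c' * K ^ n) = ln c' + real n * ln K" using c' K by (simp add: ln_mult ln_realpow)
      moreover have "- ln c' \<le> real n * (ln K / 2)" using n0[OF True] by simp
      ultimately have l: "real n * (ln K / 2) \<le> ln (infnorm t)" by (simp add: field_simps)
      have "\<phi> t \<le> C0 * ln (infnorm t) powr (- s)" using T[OF iT] by simp
      also have "\<dots> \<le> C0 * (real n * (ln K / 2)) powr (- s)"
        using C0 l lK n s by (intro mult_left_mono powr_mono2') auto
      also have "\<dots> = C0 * (ln K / 2) powr (- s) * real n powr (- s)" by (simp only: powr_mult mult_ac)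
      also have "\<dots> \<le> C * real n powr (- s)" unfolding C_def by (intro mult_right_mono) auto
      finally show ?thesis .
    next
      case False
      have "\<phi> t \<le> 1" using bd[of t] by simp
      also have "1 = real n powr s * real n powr (- s)" using n by (simp flip: powr_add)
      also have "\<dots> \<le> C * real n powr (- s)"
      proof (rule mult_right_mono)
        have "real n powr s \<le> (real n0 + 1) powr s" using False s by (intro powr_mono2) auto
        then show "real n powr s \<le> C" unfolding C_def using C0 by (simp add: add_increasing)
      qed simp
      finally show ?thesis .
    qed
  qed
qed

section \<open>Hitting probabilities and the variance\<close>

lemma triangle_bounds: "0 < r \<Longrightarrow> 0 \<le> triangle r x \<and> triangle r x \<le> 1"
  using dist_int_nonneg[of x] by (simp add: triangle_def)

lemma triangle_measurable [measurable]: "triangle r \<in> borel_measurable borel"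
  unfolding triangle_def[abs_def] by measurable

lemma affine_measurable [measurable]:
  fixes B :: "real ^ 'n::finite ^ 'n"
  shows "(\<lambda>x. B *v x - y) \<in> borel_measurable borel"
  by (intro borel_measurable_continuous_onI continuous_intros)

lemma component_measurable [measurable]: "(\<lambda>x :: real ^ 'n::finite. x $ i) \<in> borel_measurable borel"
  by (intro borel_measurable_continuous_onI continuous_intros)

lemma sum_geometric_le:
  fixes f :: "nat \<Rightarrow> nat" and q :: real
  assumes "0 \<le> q" "q < 1" "finite I" "inj_on f I" shows "(\<Sum>n\<in>I. q ^ f n) \<le> 1 / (1 - q)"
proof -
  have "(\<Sum>n\<in>I. q ^ f n) = (\<Sum>j\<in>f ` I. q ^ j)" using assms by (simp add: sum.reindex)
  also have "\<dots> \<le> (\<Sum>j. q ^ j)"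
    using assms by (intro sum_le_suminf summable_geometric) auto
  also have "\<dots> = 1 / (1 - q)" using assms by (intro suminf_geometric) auto
  finally show ?thesis .
qed

text \<open>
  By symmetry it suffices to bound the terms on and above the diagonal.
\<close>
lemma sum_triangle_half:
  fixes V U :: "nat \<Rightarrow> nat \<Rightarrow> real"
  assumes "finite I" and V: "\<And>m n. m \<in> I \<Longrightarrow> n \<in> I \<Longrightarrow> V m n = V n m"
    and U: "\<And>m n. m \<in> I \<Longrightarrow> n \<in> I \<Longrightarrow> m \<le> n \<Longrightarrow> V m n \<le> U m n"
    and U0: "\<And>m n. 0 \<le> U m n"
  shows "(\<Sum>m\<in>I. \<Sum>n\<in>I. V m n) \<le> 2 * (\<Sum>m\<in>I. \<Sum>n | n \<in> I \<and> m \<le> n. U m n)"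
proof -
  define W where "W m n = (if m \<le> n then U m n else 0)" for m n
  have "(\<Sum>m\<in>I. \<Sum>n\<in>I. V m n) \<le> (\<Sum>m\<in>I. \<Sum>n\<in>I. W m n + W n m)"
  proof (intro sum_mono)
    fix m n assume mn: "m \<in> I" "n \<in> I"
    show "V m n \<le> W m n + W n m"
    proof (cases "m \<le> n")
      case True
      moreover have "0 \<le> W n m" using U0 by (simp add: W_def)
      ultimately show ?thesis using U[OF mn True] by (simp add: W_def)
    next
      case False
      then show ?thesis using U[OF mn(2,1)] V[OF mn] by (simp add: W_def)
    qed
  qed
  also have "\<dots> = (\<Sum>m\<in>I. \<Sum>n\<in>I. W m n) + (\<Sum>m\<in>I. \<Sum>n\<in>I. W n m)" by (simp add: sum.distrib)
  also have "(\<Sum>m\<in>I. \<Sum>n\<in>I. W n m) = (\<Sum>m\<in>I. \<Sum>n\<in>I. W m n)" by (rule sum.swap)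
  finally have "(\<Sum>m\<in>I. \<Sum>n\<in>I. V m n) \<le> 2 * (\<Sum>m\<in>I. \<Sum>n\<in>I. W m n)" by simp
  moreover have "(\<Sum>n\<in>I. W m n) = (\<Sum>n | n \<in> I \<and> m \<le> n. U m n)" for m
    using assms(1) by (simp add: W_def sum.inter_filter)
  ultimately show ?thesis by simp
qed

definition triangle_box :: "('n::finite \<Rightarrow> real) \<Rightarrow> real ^ 'n \<Rightarrow> real" where
  "triangle_box r z = (\<Prod>i\<in>UNIV. triangle (r i) (z $ i))"

lemma triangle_box_bounds:
  assumes "\<And>i. 0 < r i" shows "0 \<le> triangle_box r z" "triangle_box r z \<le> 1"
  unfolding triangle_box_def using triangle_bounds[OF assms] by (auto intro: prod_nonneg prod_le_1)

lemma triangle_box_measurable [measurable]: "triangle_box r \<in> borel_measurable borel"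
  unfolding triangle_box_def[abs_def] by measurable

lemma box_coeff_triangle_zero: "triangle_box_coeff r (\<lambda>_. 0) = (\<Prod>i\<in>UNIV. r i)"
  by (simp add: box_coeff_def triangle_coeff_def)

lemma trig_poly_triangle_tendsto:
  assumes "\<And>i. 0 < r i \<and> r i \<le> 1/2"
  shows "(\<lambda>M. trig_poly (\<lambda>i. triangle_coeff (r i)) M z) \<longlonglongrightarrow> of_real (triangle_box r z)"
  unfolding triangle_box_def using assms by (intro trig_poly_tendsto triangle_series) auto

context torus_prob
begin

text \<open>
  The bound for trigonometric polynomials passes to their pointwise limit g by dominated convergence.
\<close>
lemma integral_box_kernel_le:
  fixes c :: "'n \<Rightarrow> int \<Rightarrow> real"
  assumes c: "\<And>k. 0 \<le> box_coeff c k" "\<And>F. finite F \<Longrightarrow> sum (box_coeff c) F \<le> 1"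
    and \<delta>: "\<And>k. k \<noteq> (\<lambda>_. 0) \<Longrightarrow> norm (fourier_coeff \<mu> (transpose B *v freq_vec k)) \<le> \<delta>" "0 \<le> \<delta>"
    and g: "\<And>z. (\<lambda>M. trig_poly c M z) \<longlonglongrightarrow> of_real (g z)"
    and gm: "g \<in> borel_measurable borel"
  shows "(\<integral>x. g (B *v x - y) \<partial>\<mu>) \<le> box_coeff c (\<lambda>_. 0) + \<delta>"
proof -
  have [measurable]: "(\<lambda>x. B *v x - y) \<in> borel_measurable \<mu>" by (rule borel_measurable_mu) measurable
  note gm [measurable]
  have "(\<lambda>M. \<integral>x. trig_poly c M (B *v x - y) \<partial>\<mu>) \<longlonglongrightarrow> (\<integral>x. complex_of_real (g (B *v x - y)) \<partial>\<mu>)"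
    by (rule integral_dominated_convergence[where w = "\<lambda>_. 1"])
       (use g trig_poly_norm_le_1[OF c] in auto)
  then have "(\<lambda>M. norm (\<integral>x. trig_poly c M (B *v x - y) \<partial>\<mu>)) \<longlonglongrightarrow> norm (\<integral>x. complex_of_real (g (B *v x - y)) \<partial>\<mu>)"
    by (rule tendsto_norm)
  then have "norm (\<integral>x. complex_of_real (g (B *v x - y)) \<partial>\<mu>) \<le> box_coeff c (\<lambda>_. 0) + \<delta>"
    by (rule LIMSEQ_le_const2) (use integral_trig_poly_le[OF c \<delta>] in auto)
  then show ?thesis by simp
qed

end

text \<open>
  The decay is recorded in the form in which it is used, at the scale of A_n, together with the
  growth constant c of the transposed matrices that fixes this scale.
\<close>
locale lacunary_decay = torus_prob \<mu> + lacunary_matrices A K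
  for \<mu> :: "(real ^ 'n::finite) measure" and A :: "nat \<Rightarrow> real ^ 'n ^ 'n" and K :: real +
  fixes c C\<^sub>d s :: real
  assumes c: "c > 0" and C\<^sub>d: "C\<^sub>d > 0" and s: "s > 2"
    and transpose_large: "\<And>n x. n \<ge> 1 \<Longrightarrow> c * K ^ n * norm x \<le> norm (transpose (A n) *v x)"
    and decay: "\<And>n t. n \<ge> 1 \<Longrightarrow> c / 2 * K ^ n \<le> norm t \<Longrightarrow> norm (fourier_coeff \<mu> t) \<le> C\<^sub>d * real n powr (- s)"
begin

lemma decay_freq:
  assumes "n \<ge> 1" "k \<noteq> (\<lambda>_. 0)" shows "norm (fourier_coeff \<mu> (transpose (A n) *v freq_vec k)) \<le> C\<^sub>d * real n powr (- s)"
proof (rule decay[OF assms(1)])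
  have "c / 2 * K ^ n * 1 \<le> c * K ^ n * norm (freq_vec k)"
    using freq_vec_ge_1[OF assms(2)] c K1 by (intro mult_mono) auto
  also have "\<dots> \<le> norm (transpose (A n) *v freq_vec k)" by (rule transpose_large[OF assms(1)])
  finally show "c / 2 * K ^ n \<le> norm (transpose (A n) *v freq_vec k)" by simp
qed

text \<open>
  The triangle of radius 2 r is at least 1/2 on [-r,r]. This requires 2 r \<le> 1/2; for r > 1/4 the
  constant 1 is used instead, and its mean 1 is still at most 4 r.
\<close>
lemma measure_box_hit_le:
  fixes r :: "'n \<Rightarrow> real"
  assumes n: "n \<ge> 1" and r: "\<And>i. 0 < r i" "\<And>i. r i < 1/2"
  shows "measure \<mu> {x \<in> space \<mu>. \<forall>i. dist_int ((A n *v x - y) $ i) \<le> r i}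
      \<le> 2 ^ CARD('n) * (4 ^ CARD('n) * (\<Prod>i\<in>UNIV. r i) + C\<^sub>d * real n powr (- s))"
proof -
  define b where "b i = (if r i \<le> 1/4 then triangle_coeff (2 * r i) else (\<lambda>j. if j = 0 then 1 else 0))" for i
  define g where "g i = (if r i \<le> 1/4 then triangle (2 * r i) else (\<lambda>_. 1))" for i
  define G where "G z = (\<Prod>i\<in>UNIV. g i (z $ i))" for z :: "real ^ 'n"
  have b0: "0 \<le> b i j" for i j using r by (simp add: b_def triangle_coeff_nonneg)
  have bs: "sum (b i) F \<le> 1" if "finite F" for i F
    using triangle_coeff_sum_le_1[of "2 * r i" F] that r[of i] by (simp add: b_def sum.delta)
  have c0: "0 \<le> box_coeff b k" for k unfolding box_coeff_def using b0 by (intro prod_nonneg) auto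
  have cs: "sum (box_coeff b) F \<le> 1" if "finite F" for F
  proof -
    have "sum (box_coeff b) F \<le> (\<Prod>i\<in>(UNIV::'n set). 1)"
      unfolding box_coeff_def by (intro sum_prod_le that b0 bs)
    then show ?thesis by simp
  qed
  have gm [measurable]: "G \<in> borel_measurable borel"
  proof -
    have [measurable]: "g i \<in> borel_measurable borel" for i by (simp add: g_def)
    show ?thesis unfolding G_def[abs_def] by measurable
  qed
  have glim: "(\<lambda>M. trig_poly b M z) \<longlonglongrightarrow> of_real (G z)" for z
    unfolding G_def
  proof (rule trig_poly_tendsto)
    fix i
    show "(\<lambda>M. \<Sum>j\<in>{-int M..int M}. of_real (b i j) * cis (2 * pi * (of_int j * z $ i))) \<longlonglongrightarrow> complex_of_real (g i (z $ i))"
    proof (cases "r i \<le> 1/4")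
      case True
      then show ?thesis using triangle_series[of "2 * r i" "z $ i"] r(1)[of i] by (simp add: b_def g_def)
    next
      case False
      then have "(\<Sum>j\<in>{-int M..int M}. of_real (b i j) * cis (2 * pi * (of_int j * z $ i))) = 1" for M
      proof -
        have "(\<Sum>j\<in>{-int M..int M}. of_real (b i j) * cis (2 * pi * (of_int j * z $ i)))
            = (\<Sum>j\<in>{-int M..int M}. if j = 0 then 1 else 0)"
          using False by (intro sum.cong) (auto simp: b_def)
        then show ?thesis by (simp add: sum.delta)
      qed
      then show ?thesis using False by (simp add: g_def)
    qed
  qed
  have g0: "0 \<le> g i u" "g i u \<le> 1" for i u using triangle_bounds[of "2 * r i" u] r(1)[of i] by (auto simp: g_def)
  have ghalf: "1/2 \<le> g i u" if "dist_int u \<le> r i" for i u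
  proof -
    have "dist_int u / (2 * r i) \<le> r i / (2 * r i)" using that r(1)[of i] by (intro divide_right_mono) auto
    then show ?thesis using r(1)[of i] by (simp add: g_def triangle_def)
  qed
  have am [measurable]: "(\<lambda>x. A n *v x - y) \<in> borel_measurable \<mu>" by (rule borel_measurable_mu) measurable
  define S where "S = {x \<in> space \<mu>. \<forall>i. dist_int ((A n *v x - y) $ i) \<le> r i}"
  have S [measurable]: "S \<in> sets \<mu>" unfolding S_def by measurable
  have "measure \<mu> S = (\<integral>x. indicat_real S x \<partial>\<mu>)" by simp
  also have "\<dots> \<le> (\<integral>x. 2 ^ CARD('n) * G (A n *v x - y) \<partial>\<mu>)"
  proof (rule integral_mono)
    show "integrable \<mu> (indicat_real S)" by (rule integrable_const_bound[where B = 1]) auto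
    have "\<bar>2 ^ CARD('n) * G (A n *v x - y)\<bar> \<le> 2 ^ CARD('n)" for x
      unfolding G_def using g0 by (auto simp: abs_mult abs_prod intro!: prod_le_1)
    then show "integrable \<mu> (\<lambda>x. 2 ^ CARD('n) * G (A n *v x - y))"
      by (intro integrable_const_bound[where B = "2 ^ CARD('n)"]) auto
    fix x
    show "indicat_real S x \<le> 2 ^ CARD('n) * G (A n *v x - y)"
    proof (cases "x \<in> S")
      case True
      then have "1/2 \<le> g i ((A n *v x - y) $ i)" for i
        by (intro ghalf) (simp add: S_def)
      then have "(\<Prod>i\<in>(UNIV::'n set). 1/2) \<le> G (A n *v x - y)"
        unfolding G_def by (intro prod_mono conjI) simp_all
      then show ?thesis using True by (simp add: power_divide divide_le_eq mult.commute)
    next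
      case False
      then show ?thesis unfolding G_def using g0 by (simp add: prod_nonneg)
    qed
  qed
  also have "\<dots> = 2 ^ CARD('n) * (\<integral>x. G (A n *v x - y) \<partial>\<mu>)" by simp
  also have "\<dots> \<le> 2 ^ CARD('n) * (box_coeff b (\<lambda>_. 0) + C\<^sub>d * real n powr (- s))"
    using C\<^sub>d by (intro mult_left_mono integral_box_kernel_le[OF c0 cs decay_freq[OF n] _ glim gm]) auto
  also have "\<dots> \<le> 2 ^ CARD('n) * (4 ^ CARD('n) * (\<Prod>i\<in>UNIV. r i) + C\<^sub>d * real n powr (- s))"
  proof (intro mult_left_mono add_right_mono)
    have "box_coeff b (\<lambda>_. 0) \<le> (\<Prod>i\<in>UNIV. 4 * r i)"
      unfolding box_coeff_def by (intro prod_mono conjI b0) (use r in \<open>auto simp: b_def triangle_coeff_def less_imp_le\<close>)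
    then show "box_coeff b (\<lambda>_. 0) \<le> 4 ^ CARD('n) * (\<Prod>i\<in>UNIV. r i)" by (simp add: prod.distrib)
  qed simp
  finally show ?thesis by (simp add: S_def)
qed

text \<open>
  The truncated Fourier series are exponential sums without constant term after subtraction of the
  mean, so \<open>integral_norm_square_exponential_sum\<close> and \<open>pair_correlation\<close> bound their second
  moments; dominated convergence then lets the truncation M tend to infinity. The lower bound on the
  volumes also bounds each single radius from below by n^(-2).
\<close>
lemma variance_le:
  obtains C where "C > 0" and "\<And>I (r :: 'n \<Rightarrow> nat \<Rightarrow> real) y. finite I \<Longrightarrow>
     (\<And>n. n \<in> I \<Longrightarrow> 1 \<le> n) \<Longrightarrow> (\<And>n i. n \<in> I \<Longrightarrow> 0 < r i n \<and> r i n \<le> 1/2) \<Longrightarrow>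
     (\<And>n. n \<in> I \<Longrightarrow> real n powr (-2) \<le> (\<Prod>i\<in>UNIV. r i n)) \<Longrightarrow>
     (\<integral>x. (\<Sum>n\<in>I. triangle_box (\<lambda>i. r i n) (A n *v x - y) - (\<Prod>i\<in>UNIV. r i n))\<^sup>2 \<partial>\<mu>)
       \<le> C * ((\<Sum>n\<in>I. \<Prod>i\<in>UNIV. r i n) + 1)"
proof -
  obtain C1 where C1: "C1 > 0" and pair: "\<And>m n (r :: 'n \<Rightarrow> real) r' \<rho> c \<phi> dm dn M. 1 \<le> m \<Longrightarrow> m \<le> n \<Longrightarrow>
     (\<forall>i. 0 < r i \<and> r i \<le> 1/2 \<and> \<rho> \<le> r i) \<Longrightarrow> (\<forall>i. 0 < r' i \<and> r' i \<le> 1/2) \<Longrightarrow> 0 < \<rho> \<Longrightarrow> 0 < c \<Longrightarrow>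
     (\<forall>x. c * K ^ m * norm x \<le> norm (transpose (A m) *v x)) \<Longrightarrow>
     (\<forall>t. \<phi> t \<le> 1) \<Longrightarrow> 0 \<le> dm \<Longrightarrow> 0 \<le> dn \<Longrightarrow>
     (\<forall>t. c / 2 * K ^ m \<le> norm t \<longrightarrow> \<phi> t \<le> dm) \<Longrightarrow> (\<forall>t. c / 2 * K ^ n \<le> norm t \<longrightarrow> \<phi> t \<le> dn) \<Longrightarrow>
     (\<Sum>k\<in>freq_box M - {\<lambda>_. 0}. \<Sum>l\<in>freq_box M - {\<lambda>_. 0}.
        triangle_box_coeff r k * triangle_box_coeff r' l * \<phi> (transpose (A m) *v freq_vec k - transpose (A n) *v freq_vec l))
     \<le> C1 * (((\<Prod>i\<in>UNIV. r i) + (\<Prod>i\<in>UNIV. r' i)) / K ^ (n - m) + dn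
              + dm * (\<rho> powr (-1/4) * (K ^ (n - m)) powr (-1/8)))"
    by (rule pair_correlation) (rule that)
  define q where "q = 1 / K"
  have q: "0 \<le> q" "q < 1" using K1 by (auto simp: q_def)
  define q' where "q' = K powr (-1/8)"
  have q': "0 \<le> q'" "q' < 1" using K1 powr_less_mono[of "-1/8" 0 K] by (auto simp: q'_def)
  define S1 where "S1 = (\<Sum>n. real n powr (1 - s))"
  have sm: "summable (\<lambda>n. real n powr (1 - s))" using s by (simp add: summable_real_powr_iff)
  have S1: "S1 \<ge> 0" unfolding S1_def by (intro suminf_nonneg sm) auto
  have S1le: "(\<Sum>n\<in>I. real n powr (1 - s)) \<le> S1" if "finite I" for I
    unfolding S1_def by (intro sum_le_suminf sm that) auto
  define C where "C = 2 * C1 * (2 * (1 / (1 - q)) + C\<^sub>d * S1 + C\<^sub>d * (1 / (1 - q')) * S1)"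
  have "C > 0" unfolding C_def using C1 C\<^sub>d S1 q q'
    by (intro mult_pos_pos add_pos_nonneg mult_nonneg_nonneg) auto
  show ?thesis
  proof (rule that[OF \<open>C > 0\<close>])
    fix I :: "nat set" and r :: "'n \<Rightarrow> nat \<Rightarrow> real" and y :: "real ^ 'n"
    assume I: "finite I"
      and n1: "\<And>n. n \<in> I \<Longrightarrow> 1 \<le> n" and r01: "\<And>n i. n \<in> I \<Longrightarrow> 0 < r i n \<and> r i n \<le> 1/2"
      and plow: "\<And>n. n \<in> I \<Longrightarrow> real n powr (-2) \<le> (\<Prod>i\<in>UNIV. r i n)"
    define p where "p n = (\<Prod>i\<in>UNIV. r i n)" for n
    define \<Phi> where "\<Phi> = (\<Sum>n\<in>I. p n)"
    have rr: "0 < r i n" "r i n \<le> 1/2" if "n \<in> I" for i n using r01[OF that] by auto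
    have p0: "0 \<le> p n" if "n \<in> I" for n
      unfolding p_def using rr[OF that] by (auto intro!: prod_nonneg simp: less_imp_le)
    have \<Phi>0: "0 \<le> \<Phi>" unfolding \<Phi>_def by (intro sum_nonneg p0)
    \<comment> \<open>The other radii are at most 1, so each radius is at least the volume of the box.\<close>
    have rlow: "real n powr (-2) \<le> r i n" if "n \<in> I" for i n
    proof -
      have "p n = r i n * (\<Prod>j\<in>UNIV - {i}. r j n)" unfolding p_def by (rule prod.remove) auto
      also have "\<dots> \<le> r i n * 1"
        using rr[OF that] by (intro mult_left_mono prod_le_1) (auto simp: less_imp_le intro: order_trans[of _ "1/2"])
      finally have "p n \<le> r i n" by simp
      then show ?thesis using plow[OF that] unfolding p_def by linarith
    qed
    define a where "a n = triangle_box_coeff (\<lambda>i. r i n)" for n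
    define \<phi> where "\<phi> t = norm (fourier_coeff \<mu> t)" for t
    define v where "v n k = transpose (A n) *v freq_vec k" for n k
    define U where "U m n = C1 * ((p m + p n) * q ^ (n - m) + C\<^sub>d * real n powr (- s)
        + C\<^sub>d * real m powr (1/2 - s) * q' ^ (n - m))" for m n
    have double: "(\<Sum>m\<in>I. \<Sum>n\<in>I. \<Sum>k\<in>freq_box M - {\<lambda>_. 0}. \<Sum>l\<in>freq_box M - {\<lambda>_. 0}. a m k * a n l * \<phi> (v m k - v n l))
        \<le> C * (\<Phi> + 1)" for M
    proof -
      define X where "X = freq_box M - {\<lambda>_::'n. 0::int}"
      define V where "V m n = (\<Sum>k\<in>X. \<Sum>l\<in>X. a m k * a n l * \<phi> (v m k - v n l))" for m n
      have "(\<Sum>m\<in>I. \<Sum>n\<in>I. V m n) \<le> 2 * (\<Sum>m\<in>I. \<Sum>n | n \<in> I \<and> m \<le> n. max 0 (U m n))"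
      proof (rule sum_triangle_half[OF I])
        fix m n assume mn: "m \<in> I" "n \<in> I"
        have \<phi>sym: "\<phi> (t - t') = \<phi> (t' - t)" for t t'
          using norm_fourier_coeff_minus[of "t - t'"] by (simp add: \<phi>_def)
        have "V m n = (\<Sum>l\<in>X. \<Sum>k\<in>X. a m k * a n l * \<phi> (v m k - v n l))" unfolding V_def by (rule sum.swap)
        also have "\<dots> = V n m" unfolding V_def by (intro sum.cong refl) (simp only: \<phi>sym mult_ac)
        finally show "V m n = V n m" .
        assume le: "m \<le> n"
        have "V m n \<le> C1 * ((p m + p n) / K ^ (n - m) + C\<^sub>d * real n powr (- s)
            + C\<^sub>d * real m powr (- s) * ((real m powr (-2)) powr (-1/4) * (K ^ (n - m)) powr (-1/8)))"
          unfolding V_def a_def v_def X_def p_def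
        proof (rule pair)
          show "\<forall>t. c / 2 * K ^ m \<le> norm t \<longrightarrow> \<phi> t \<le> C\<^sub>d * real m powr (- s)"
            unfolding \<phi>_def using decay n1[OF mn(1)] by blast
          show "\<forall>t. c / 2 * K ^ n \<le> norm t \<longrightarrow> \<phi> t \<le> C\<^sub>d * real n powr (- s)"
            unfolding \<phi>_def using decay n1[OF mn(2)] by blast
          show "\<forall>i. 0 < r i m \<and> r i m \<le> 1 / 2 \<and> real m powr - 2 \<le> r i m"
            using rr[OF mn(1)] rlow[OF mn(1)] by auto
          show "\<forall>i. 0 < r i n \<and> r i n \<le> 1 / 2" using rr[OF mn(2)] by auto
          show "\<forall>t. \<phi> t \<le> 1" unfolding \<phi>_def using norm_fourier_coeff_le_1 by blast
        qed (use n1[OF mn(1)] le c C\<^sub>d transpose_large in auto)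
        also have "(real m powr (-2)) powr (-1/4) = real m powr (1/2)" by (simp add: powr_powr)
        also have "(K ^ (n - m)) powr (-1/8) = q' ^ (n - m)"
          using K1 by (simp add: q'_def powr_power powr_powr mult.commute flip: powr_realpow)
        also have "(p m + p n) / K ^ (n - m) = (p m + p n) * q ^ (n - m)" by (simp add: q_def power_divide)
        also have "C\<^sub>d * real m powr (- s) * (real m powr (1/2) * q' ^ (n - m)) = C\<^sub>d * real m powr (1/2 - s) * q' ^ (n - m)"
          using powr_add[of "real m" "- s" "1/2"] by (simp add: mult_ac)
        finally show "V m n \<le> max 0 (U m n)" by (simp add: U_def)
      qed simp
      also have "(\<Sum>m\<in>I. \<Sum>n | n \<in> I \<and> m \<le> n. max 0 (U m n)) = (\<Sum>m\<in>I. \<Sum>n | n \<in> I \<and> m \<le> n. U m n)"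
      proof (intro sum.cong refl)
        fix m n assume mn: "m \<in> I" "n \<in> {n. n \<in> I \<and> m \<le> n}"
        have "0 \<le> U m n" unfolding U_def using C1 C\<^sub>d p0 mn q q'
          by (intro mult_nonneg_nonneg add_nonneg_nonneg) auto
        then show "max 0 (U m n) = U m n" by simp
      qed
      also have "\<dots> = C1 * ((\<Sum>m\<in>I. \<Sum>n | n \<in> I \<and> m \<le> n. p m * q ^ (n - m))
          + (\<Sum>m\<in>I. \<Sum>n | n \<in> I \<and> m \<le> n. p n * q ^ (n - m))
          + (\<Sum>m\<in>I. \<Sum>n | n \<in> I \<and> m \<le> n. C\<^sub>d * real n powr (- s))
          + (\<Sum>m\<in>I. \<Sum>n | n \<in> I \<and> m \<le> n. C\<^sub>d * real m powr (1/2 - s) * q' ^ (n - m)))"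
        by (simp add: U_def sum_distrib_left sum.distrib distrib_left distrib_right)
      also have "\<dots> \<le> C1 * (\<Phi> * (1 / (1 - q)) + \<Phi> * (1 / (1 - q)) + C\<^sub>d * S1 + C\<^sub>d * (1 / (1 - q')) * S1)"
      proof (intro mult_left_mono add_mono)
        have "(\<Sum>m\<in>I. \<Sum>n | n \<in> I \<and> m \<le> n. p m * q ^ (n - m)) = (\<Sum>m\<in>I. p m * (\<Sum>n | n \<in> I \<and> m \<le> n. q ^ (n - m)))"
          by (simp add: sum_distrib_left)
        also have "\<dots> \<le> (\<Sum>m\<in>I. p m * (1 / (1 - q)))"
          using I q p0 by (intro sum_mono mult_left_mono sum_geometric_le) (auto simp: inj_on_def)
        finally show "(\<Sum>m\<in>I. \<Sum>n | n \<in> I \<and> m \<le> n. p m * q ^ (n - m)) \<le> \<Phi> * (1 / (1 - q))"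
          unfolding \<Phi>_def sum_distrib_right .
        have "(\<Sum>m\<in>I. \<Sum>n | n \<in> I \<and> m \<le> n. p n * q ^ (n - m)) = (\<Sum>n\<in>I. \<Sum>m | m \<in> I \<and> m \<le> n. p n * q ^ (n - m))"
          using I by (rule sum.swap_restrict) (rule I)
        also have "\<dots> = (\<Sum>n\<in>I. p n * (\<Sum>m | m \<in> I \<and> m \<le> n. q ^ (n - m)))" by (simp add: sum_distrib_left)
        also have "\<dots> \<le> (\<Sum>n\<in>I. p n * (1 / (1 - q)))"
          using I q p0 by (intro sum_mono mult_left_mono sum_geometric_le) (auto simp: inj_on_def)
        finally show "(\<Sum>m\<in>I. \<Sum>n | n \<in> I \<and> m \<le> n. p n * q ^ (n - m)) \<le> \<Phi> * (1 / (1 - q))"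
          unfolding \<Phi>_def sum_distrib_right .
        have "(\<Sum>m\<in>I. \<Sum>n | n \<in> I \<and> m \<le> n. C\<^sub>d * real n powr (- s)) = (\<Sum>n\<in>I. \<Sum>m | m \<in> I \<and> m \<le> n. C\<^sub>d * real n powr (- s))"
          using I by (rule sum.swap_restrict) (rule I)
        also have "\<dots> \<le> (\<Sum>n\<in>I. C\<^sub>d * real n powr (1 - s))"
        proof (rule sum_mono)
          fix n assume "n \<in> I"
          then have "card {m. m \<in> I \<and> m \<le> n} \<le> card {1..n}" using n1 by (intro card_mono) auto
          then have "real (card {m. m \<in> I \<and> m \<le> n}) * (C\<^sub>d * real n powr (- s)) \<le> real n * (C\<^sub>d * real n powr (- s))"
            using C\<^sub>d by (intro mult_right_mono) auto
          also have "\<dots> = C\<^sub>d * real n powr (1 - s)"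
            using powr_add[of "real n" 1 "- s"] by (simp add: mult_ac)
          finally show "(\<Sum>m | m \<in> I \<and> m \<le> n. C\<^sub>d * real n powr (- s)) \<le> C\<^sub>d * real n powr (1 - s)" by simp
        qed
        also have "\<dots> = C\<^sub>d * (\<Sum>n\<in>I. real n powr (1 - s))" by (simp add: sum_distrib_left)
        also have "\<dots> \<le> C\<^sub>d * S1" using C\<^sub>d I by (intro mult_left_mono S1le) auto
        finally show "(\<Sum>m\<in>I. \<Sum>n | n \<in> I \<and> m \<le> n. C\<^sub>d * real n powr (- s)) \<le> C\<^sub>d * S1" .
        have "(\<Sum>m\<in>I. \<Sum>n | n \<in> I \<and> m \<le> n. C\<^sub>d * real m powr (1/2 - s) * q' ^ (n - m))
            = (\<Sum>m\<in>I. C\<^sub>d * real m powr (1/2 - s) * (\<Sum>n | n \<in> I \<and> m \<le> n. q' ^ (n - m)))"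
          by (simp add: sum_distrib_left)
        also have "\<dots> \<le> (\<Sum>m\<in>I. C\<^sub>d * real m powr (1 - s) * (1 / (1 - q')))"
          using I q' C\<^sub>d n1
          by (intro sum_mono mult_mono sum_geometric_le mult_nonneg_nonneg sum_nonneg powr_mono order_refl)
             (auto simp: inj_on_def)
        also have "\<dots> = C\<^sub>d * (1 / (1 - q')) * (\<Sum>m\<in>I. real m powr (1 - s))" by (simp add: sum_distrib_left mult_ac)
        also have "\<dots> \<le> C\<^sub>d * (1 / (1 - q')) * S1" using C\<^sub>d I q' by (intro mult_left_mono S1le) auto
        finally show "(\<Sum>m\<in>I. \<Sum>n | n \<in> I \<and> m \<le> n. C\<^sub>d * real m powr (1/2 - s) * q' ^ (n - m)) \<le> C\<^sub>d * (1 / (1 - q')) * S1" .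
      qed (use C1 in simp)
      finally have le: "(\<Sum>m\<in>I. \<Sum>n\<in>I. V m n) \<le> 2 * (C1 * (\<Phi> * (1 / (1 - q)) + \<Phi> * (1 / (1 - q)) + C\<^sub>d * S1 + C\<^sub>d * (1 / (1 - q')) * S1))"
        by simp
      define P Q where "P = 2 * (1 / (1 - q))" and "Q = C\<^sub>d * S1 + C\<^sub>d * (1 / (1 - q')) * S1"
      have PQ: "0 \<le> P" "0 \<le> Q" unfolding P_def Q_def using q q' C\<^sub>d S1 by auto
      have "\<Phi> * (1 / (1 - q)) + \<Phi> * (1 / (1 - q)) + C\<^sub>d * S1 + C\<^sub>d * (1 / (1 - q')) * S1 = P * \<Phi> + Q"
        by (simp add: P_def Q_def)
      also have "\<dots> \<le> (P + Q) * (\<Phi> + 1)" using PQ \<Phi>0 by (simp add: algebra_simps)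
      finally have "2 * (C1 * (\<Phi> * (1 / (1 - q)) + \<Phi> * (1 / (1 - q)) + C\<^sub>d * S1 + C\<^sub>d * (1 / (1 - q')) * S1))
          \<le> 2 * (C1 * ((P + Q) * (\<Phi> + 1)))" using C1 by (intro mult_left_mono) auto
      also have "\<dots> = C * (\<Phi> + 1)" by (simp only: C_def P_def Q_def mult.assoc add.assoc)
      finally show ?thesis using le by (simp add: V_def X_def)
    qed
    define Z where "Z M x = (\<Sum>n\<in>I. trig_poly (\<lambda>i. triangle_coeff (r i n)) M (A n *v x - y) - of_real (p n))" for M x
    define S where "S x = (\<Sum>n\<in>I. triangle_box (\<lambda>i. r i n) (A n *v x - y) - p n)" for x
    have Zle: "(\<integral>x. (norm (Z M x))\<^sup>2 \<partial>\<mu>) \<le> C * (\<Phi> + 1)" for M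
    proof -
      define X where "X = freq_box M - {\<lambda>_::'n. 0::int}"
      define w where "w j = a (fst j) (snd j)" for j
      define vv where "vv j = v (fst j) (snd j)" for j
      define \<beta> where "\<beta> j = - (2 * pi * (freq_vec (snd j) \<bullet> y))" for j :: "nat \<times> ('n \<Rightarrow> int)"
      have w0: "0 \<le> w j" if "j \<in> I \<times> X" for j
        unfolding w_def a_def using rr that by (intro triangle_box_coeff_nonneg) auto
      have Zeq: "Z M x = (\<Sum>j\<in>I \<times> X. of_real (w j) * cis (2 * pi * (vv j \<bullet> x) + \<beta> j))" for x
      proof -
        have "Z M x = (\<Sum>n\<in>I. \<Sum>k\<in>X. of_real (a n k) * cis (2 * pi * (freq_vec k \<bullet> (A n *v x - y))))"
          unfolding Z_def trig_poly_split_zero box_coeff_triangle_zero by (simp add: X_def a_def p_def)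
        also have "\<dots> = (\<Sum>n\<in>I. \<Sum>k\<in>X. of_real (w (n, k)) * cis (2 * pi * (vv (n, k) \<bullet> x) + \<beta> (n, k)))"
          unfolding phase_split by (simp add: w_def vv_def v_def \<beta>_def right_diff_distrib)
        finally show ?thesis by (simp add: sum.cartesian_product)
      qed
      have pairs: "(\<Sum>j\<in>I \<times> X. h j) = (\<Sum>m\<in>I. \<Sum>k\<in>X. h (m, k))" for h :: "_ \<Rightarrow> real"
        by (simp add: sum.cartesian_product case_prod_beta)
      have "(\<integral>x. (norm (Z M x))\<^sup>2 \<partial>\<mu>) \<le> (\<Sum>j\<in>I \<times> X. \<Sum>j'\<in>I \<times> X. w j * w j' * norm (fourier_coeff \<mu> (vv j - vv j')))"
        using integral_norm_square_exponential_sum[where J = "I \<times> X" and w = w and v = vv and \<beta> = \<beta>, OF w0] unfolding Zeq by simp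
      also have "\<dots> = (\<Sum>m\<in>I. \<Sum>k\<in>X. \<Sum>n\<in>I. \<Sum>l\<in>X. a m k * a n l * \<phi> (v m k - v n l))"
        unfolding pairs by (simp add: w_def vv_def \<phi>_def)
      also have "\<dots> = (\<Sum>m\<in>I. \<Sum>n\<in>I. \<Sum>k\<in>X. \<Sum>l\<in>X. a m k * a n l * \<phi> (v m k - v n l))"
        by (intro sum.cong refl sum.swap)
      also have "\<dots> \<le> C * (\<Phi> + 1)" using double[of M] by (simp add: X_def)
      finally show ?thesis .
    qed
    have am [measurable]: "(\<lambda>x. A n *v x - y) \<in> borel_measurable \<mu>" for n by (rule borel_measurable_mu) measurable
    have "(\<lambda>M. \<integral>x. (norm (Z M x))\<^sup>2 \<partial>\<mu>) \<longlonglongrightarrow> (\<integral>x. (S x)\<^sup>2 \<partial>\<mu>)"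
    proof (rule integral_dominated_convergence[where w = "\<lambda>_. (\<Sum>n\<in>I. 1 + p n)\<^sup>2"])
      show "(\<lambda>x. (S x)\<^sup>2) \<in> borel_measurable \<mu>" unfolding S_def by measurable
      show "(\<lambda>x. (norm (Z M x))\<^sup>2) \<in> borel_measurable \<mu>" for M unfolding Z_def by measurable
      show "AE x in \<mu>. (\<lambda>M. (norm (Z M x))\<^sup>2) \<longlonglongrightarrow> (S x)\<^sup>2"
      proof (rule AE_I2)
        fix x
        have "(\<lambda>M. (norm (Z M x))\<^sup>2) \<longlonglongrightarrow> (norm (\<Sum>n\<in>I. complex_of_real (triangle_box (\<lambda>i. r i n) (A n *v x - y)) - of_real (p n)))\<^sup>2"
          unfolding Z_def using rr by (intro tendsto_intros trig_poly_triangle_tendsto) auto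
        also have "(\<Sum>n\<in>I. complex_of_real (triangle_box (\<lambda>i. r i n) (A n *v x - y)) - of_real (p n)) = of_real (S x)"
          by (simp add: S_def)
        finally show "(\<lambda>M. (norm (Z M x))\<^sup>2) \<longlonglongrightarrow> (S x)\<^sup>2" by simp
      qed
      have "norm (Z M x) \<le> (\<Sum>n\<in>I. 1 + p n)" for M x
        unfolding Z_def
      proof (intro sum_norm_le)
        fix n assume n: "n \<in> I"
        have "norm (trig_poly (\<lambda>i. triangle_coeff (r i n)) M (A n *v x - y)) \<le> 1"
          using rr[OF n] by (intro trig_poly_norm_le_1 triangle_box_coeff_nonneg triangle_box_coeff_sum_le_1) auto
        then show "norm (trig_poly (\<lambda>i. triangle_coeff (r i n)) M (A n *v x - y) - of_real (p n)) \<le> 1 + p n"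
          using p0[OF n] by (intro order_trans[OF norm_triangle_ineq4]) auto
      qed
      then show "AE x in \<mu>. norm ((norm (Z M x))\<^sup>2) \<le> (\<Sum>n\<in>I. 1 + p n)\<^sup>2" for M
        by (intro AE_I2) (simp add: power_mono)
    qed simp
    then have "(\<integral>x. (S x)\<^sup>2 \<partial>\<mu>) \<le> C * (\<Phi> + 1)"
      by (rule LIMSEQ_le_const2) (use Zle in auto)
    then show "(\<integral>x. (\<Sum>n\<in>I. triangle_box (\<lambda>i. r i n) (A n *v x - y) - (\<Prod>i\<in>UNIV. r i n))\<^sup>2 \<partial>\<mu>)
       \<le> C * ((\<Sum>n\<in>I. \<Prod>i\<in>UNIV. r i n) + 1)"
      by (simp add: S_def \<Phi>_def p_def)
  qed
qed

end

section \<open>The zero-one law\<close>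

context lacunary_decay
begin

lemma hit_set_measurable [measurable]:
  "{x \<in> space \<mu>. \<forall>i. dist_int ((A n *v x - y) $ i) \<le> r i} \<in> sets \<mu>"
proof -
  have [measurable]: "(\<lambda>x. A n *v x - y) \<in> borel_measurable \<mu>" by (rule borel_measurable_mu) measurable
  show ?thesis by measurable
qed

definition hits :: "real ^ 'n \<Rightarrow> ('n \<Rightarrow> nat \<Rightarrow> real) \<Rightarrow> nat \<Rightarrow> (real ^ 'n) set" where
  "hits y r n = {x \<in> space \<mu>. \<forall>i. dist_int ((A n *v x - y) $ i) \<le> r i n}"

lemma hits_sets [measurable]: "hits y r n \<in> sets \<mu>"
  unfolding hits_def by measurable

lemma shrinking_target_set_eq:
  "shrinking_target_set A y (target_box r) = {x \<in> space \<mu>. infinite {n. 1 \<le> n \<and> x \<in> hits y r n}}"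
  unfolding shrinking_target_set_def hits_target_box_iff space_mu hits_def
  by (intro Collect_cong conj_cong refl) auto

lemma shrinking_target_set_limsup:
  "shrinking_target_set A y (target_box r) = limsup (\<lambda>n. hits y r (Suc n))"
proof -
  have "infinite {n. 1 \<le> n \<and> x \<in> hits y r n} \<longleftrightarrow> infinite {n. x \<in> hits y r (Suc n)}" for x
  proof -
    have "{n. 1 \<le> n \<and> x \<in> hits y r n} = Suc ` {n. x \<in> hits y r (Suc n)}"
      by (auto simp: image_iff) (metis Suc_le_D)
    then show ?thesis by (simp add: finite_image_iff)
  qed
  then show ?thesis
    unfolding shrinking_target_set_eq limsup_INF_SUP
    by (auto simp: infinite_nat_iff_unbounded_le hits_def)
qed

lemma measure_shrinking_targets_convergent:
  assumes r: "\<And>i n. n \<ge> 1 \<Longrightarrow> 0 < r i n \<and> r i n < 1/2"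
    and sm: "summable (\<lambda>n. \<Prod>i\<in>UNIV. r i (Suc n))"
  shows "measure \<mu> (shrinking_target_set A y (target_box r)) = 0"
proof -
  have sm2: "summable (\<lambda>n. 2 ^ CARD('n) * (4 ^ CARD('n) * (\<Prod>i\<in>UNIV. r i (Suc n)) + C\<^sub>d * real (Suc n) powr (- s)))"
  proof (intro summable_mult summable_add sm)
    show "summable (\<lambda>n. real (Suc n) powr (- s))"
      using s by (subst summable_Suc_iff) (simp add: summable_real_powr_iff)
  qed
  have "summable (\<lambda>n. measure \<mu> (hits y r (Suc n)))"
  proof (rule summable_comparison_test'[OF sm2])
    fix n
    show "norm (measure \<mu> (hits y r (Suc n))) \<le> 2 ^ CARD('n) * (4 ^ CARD('n) * (\<Prod>i\<in>UNIV. r i (Suc n)) + C\<^sub>d * real (Suc n) powr (- s))"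
      using measure_box_hit_le[of "Suc n" "\<lambda>i. r i (Suc n)" y] r by (simp add: hits_def)
  qed
  then have "limsup (\<lambda>n. hits y r (Suc n)) \<in> null_sets \<mu>"
    by (intro borel_cantelli_limsup1) (auto simp: emeasure_eq_measure)
  then show ?thesis unfolding shrinking_target_set_limsup by (simp add: measure_eq_0_null_sets)
qed

text \<open>
  On the set B L where all partial sums stay below L, S_N differs from \<Phi>_N by at least \<Phi>_N / 2 once
  \<Phi>_N is large, so by Chebyshev's inequality B L has measure at most 4 C (\<Phi>_N + 1) / \<Phi>_N^2, which
  tends to 0. A point with only L hits lies in B L, since each f_n is at most the
  indicator of a hit.
\<close>
lemma measure_shrinking_targets_divergent:
  assumes r: "\<And>i n. n \<ge> 1 \<Longrightarrow> 0 < r i n \<and> r i n < 1/2"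
    and div: "\<not> summable (\<lambda>n. \<Prod>i\<in>UNIV. r i (Suc n))"
  shows "measure \<mu> (shrinking_target_set A y (target_box r)) = 1"
proof -
  define p where "p n = (\<Prod>i\<in>UNIV. r i n)" for n
  \<comment> \<open>The discarded indices have a convergent sum of volumes, so the volumes over G still diverge.\<close>
  define G where "G = {n. 1 \<le> n \<and> real n powr (-2) \<le> p n}"
  define I where "I N = G \<inter> {..N}" for N
  define \<Phi> where "\<Phi> N = (\<Sum>n\<in>I N. p n)" for N
  define f where "f n x = triangle_box (\<lambda>i. r i n) (A n *v x - y)" for n x
  have p0: "0 < p n" if "1 \<le> n" for n unfolding p_def using r[OF that] by (intro prod_pos) auto
  have G1: "1 \<le> n" if "n \<in> G" for n using that by (simp add: G_def)
  have finI: "finite (I N)" for N by (simp add: I_def)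
  have f0: "0 \<le> f n x" "f n x \<le> 1" if "1 \<le> n" for n x
    unfolding f_def using r[OF that] by (auto intro!: triangle_box_bounds)
  have [measurable]: "f n \<in> borel_measurable \<mu>" for n
  proof -
    have [measurable]: "(\<lambda>x. A n *v x - y) \<in> borel_measurable \<mu>" by (rule borel_measurable_mu) measurable
    show ?thesis unfolding f_def[abs_def] by measurable
  qed
  obtain C where C: "C > 0" and var: "\<And>N. (\<integral>x. (\<Sum>n\<in>I N. f n x - p n)\<^sup>2 \<partial>\<mu>) \<le> C * (\<Phi> N + 1)"
  proof (rule variance_le)
    fix C :: real
    assume C: "C > 0" and V: "\<And>I (r :: 'n \<Rightarrow> nat \<Rightarrow> real) y. finite I \<Longrightarrow>
     (\<And>n. n \<in> I \<Longrightarrow> 1 \<le> n) \<Longrightarrow> (\<And>n i. n \<in> I \<Longrightarrow> 0 < r i n \<and> r i n \<le> 1/2) \<Longrightarrow>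
     (\<And>n. n \<in> I \<Longrightarrow> real n powr (-2) \<le> (\<Prod>i\<in>UNIV. r i n)) \<Longrightarrow>
     (\<integral>x. (\<Sum>n\<in>I. triangle_box (\<lambda>i. r i n) (A n *v x - y) - (\<Prod>i\<in>UNIV. r i n))\<^sup>2 \<partial>\<mu>)
       \<le> C * ((\<Sum>n\<in>I. \<Prod>i\<in>UNIV. r i n) + 1)"
    show thesis
    proof (rule that[OF C])
      fix N
      show "(\<integral>x. (\<Sum>n\<in>I N. f n x - p n)\<^sup>2 \<partial>\<mu>) \<le> C * (\<Phi> N + 1)"
        unfolding f_def \<Phi>_def p_def
      proof (rule V[OF finI])
        fix n assume n: "n \<in> I N"
        then show n1: "1 \<le> n" and "real n powr (-2) \<le> (\<Prod>i\<in>UNIV. r i n)" by (auto simp: I_def G_def p_def)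
        show "0 < r i n \<and> r i n \<le> 1/2" for i using r[OF n1, of i] by simp
      qed
    qed
  qed
  have \<Phi>top: "filterlim \<Phi> at_top sequentially"
  proof -
    define h where "h n = (if n \<in> G then p n else 0)" for n
    have h0: "0 \<le> h n" for n using p0 G1 by (auto simp: h_def less_imp_le)
    have eq: "\<Phi> N = (\<Sum>n\<le>N. h n)" for N
      unfolding \<Phi>_def I_def h_def by (subst Int_commute) (rule sum.inter_restrict, simp)
    have "\<not> summable h"
    proof
      assume "summable h"
      then have "summable (\<lambda>n. h (Suc n) + real (Suc n) powr (-2))"
        by (intro summable_add) (simp_all only: summable_Suc_iff[of h] summable_Suc_iff[of "\<lambda>n. real n powr (-2)"] summable_real_powr_iff)
      moreover have "norm (p (Suc n)) \<le> h (Suc n) + real (Suc n) powr (-2)" for n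
        using p0[of "Suc n"] by (auto simp: h_def G_def)
      ultimately have "summable (\<lambda>n. p (Suc n))" by (rule summable_comparison_test'[where N = 0])
      then show False using div by (simp add: p_def)
    qed
    then have unbdd: "\<exists>N. B < \<Phi> N" for B
      using bounded_imp_summable[OF h0, where B = B] unfolding eq by (meson not_le)
    have "mono \<Phi>"
      unfolding eq[abs_def] by (intro monoI sum_mono2) (use h0 in auto)
    then show ?thesis
      unfolding filterlim_at_top eventually_sequentially
      using unbdd by (meson monoD less_imp_le order_trans)
  qed
  define B where "B L = {x \<in> space \<mu>. \<forall>N. (\<Sum>n\<in>I N. f n x) \<le> real L}" for L :: nat
  have Bm [measurable]: "B L \<in> sets \<mu>" for L unfolding B_def by measurable
  have B0: "measure \<mu> (B L) = 0" for L
  proof -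
    have bound: "measure \<mu> (B L) \<le> 4 * C * (\<Phi> N + 1) / (\<Phi> N)\<^sup>2" if N: "2 * real L + 1 \<le> \<Phi> N" for N
    proof -
      have bd: "\<bar>\<Sum>n\<in>I N. f n x - p n\<bar> \<le> (\<Sum>n\<in>I N. 1 + p n)" for x
      proof (intro order_trans[OF sum_abs] sum_mono)
        fix n assume "n \<in> I N"
        then have "1 \<le> n" using G1 by (simp add: I_def)
        then show "\<bar>f n x - p n\<bar> \<le> 1 + p n" using f0[of n x] p0[of n] by auto
      qed
      have int: "integrable \<mu> (\<lambda>x. (\<Sum>n\<in>I N. f n x - p n)\<^sup>2)"
      proof (rule integrable_const_bound[where B = "(\<Sum>n\<in>I N. 1 + p n)\<^sup>2"])
        show "AE x in \<mu>. norm ((\<Sum>n\<in>I N. f n x - p n)\<^sup>2) \<le> (\<Sum>n\<in>I N. 1 + p n)\<^sup>2"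
          using bd by (intro AE_I2) (simp add: power2_le_iff_abs_le order_trans[OF abs_ge_zero bd])
      qed measurable
      have "(\<Phi> N / 2)\<^sup>2 * measure \<mu> (B L) = (\<integral>x. (\<Phi> N / 2)\<^sup>2 * indicat_real (B L) x \<partial>\<mu>)" by simp
      also have "\<dots> \<le> (\<integral>x. (\<Sum>n\<in>I N. f n x - p n)\<^sup>2 \<partial>\<mu>)"
      proof (rule integral_mono[OF _ int])
        show "integrable \<mu> (\<lambda>x. (\<Phi> N / 2)\<^sup>2 * indicat_real (B L) x)" by (intro integrable_mult_right integrable_const_bound[where B = 1]) auto
        fix x
        show "(\<Phi> N / 2)\<^sup>2 * indicat_real (B L) x \<le> (\<Sum>n\<in>I N. f n x - p n)\<^sup>2"
        proof (cases "x \<in> B L")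
          case True
          then have "(\<Sum>n\<in>I N. f n x) \<le> real L" by (auto simp: B_def)
          then have "\<bar>\<Phi> N / 2\<bar> \<le> \<bar>\<Sum>n\<in>I N. f n x - p n\<bar>"
            using N by (simp add: sum_subtractf \<Phi>_def)
          then have "(\<Phi> N / 2)\<^sup>2 \<le> (\<Sum>n\<in>I N. f n x - p n)\<^sup>2" by (rule abs_le_square_iff[THEN iffD1])
          then show ?thesis using True by simp
        qed simp
      qed
      also have "\<dots> \<le> C * (\<Phi> N + 1)" by (rule var)
      finally have "(\<Phi> N)\<^sup>2 * measure \<mu> (B L) \<le> 4 * C * (\<Phi> N + 1)" by (simp add: power_divide)
      then show ?thesis using N by (simp add: pos_le_divide_eq mult.commute)
    qed
    have "((\<lambda>u::real. 4 * C * (u + 1) / u\<^sup>2) \<longlongrightarrow> 0) at_top" by real_asymp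
    then have lim: "(\<lambda>N. 4 * C * (\<Phi> N + 1) / (\<Phi> N)\<^sup>2) \<longlonglongrightarrow> 0"
      by (rule filterlim_compose[OF _ \<Phi>top])
    have "\<forall>\<^sub>F N in sequentially. 2 * real L + 1 \<le> \<Phi> N" using \<Phi>top unfolding filterlim_at_top by blast
    then have "\<forall>\<^sub>F N in sequentially. measure \<mu> (B L) \<le> 4 * C * (\<Phi> N + 1) / (\<Phi> N)\<^sup>2"
      by (rule eventually_mono) (rule bound)
    then have "measure \<mu> (B L) \<le> 0" by (rule tendsto_lowerbound[OF lim]) simp
    then show ?thesis by (simp add: measure_le_0_iff)
  qed
  define W where "W = shrinking_target_set A y (target_box r)"
  have Wm [measurable]: "W \<in> sets \<mu>" unfolding W_def shrinking_target_set_limsup by measurable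
  have sub: "space \<mu> - W \<subseteq> (\<Union>L. B L)"
  proof
    fix x assume x: "x \<in> space \<mu> - W"
    then have fin: "finite {n. 1 \<le> n \<and> x \<in> hits y r n}" by (simp add: W_def shrinking_target_set_eq)
    define L where "L = card {n. 1 \<le> n \<and> x \<in> hits y r n}"
    have "(\<Sum>n\<in>I N. f n x) \<le> real L" for N
    proof -
      \<comment> \<open>Off the target box some factor of the triangle function vanishes.\<close>
      have "f n x \<le> of_bool (x \<in> hits y r n)" if "n \<in> I N" for n
      proof (cases "x \<in> hits y r n")
        case False
        then obtain i where i: "\<not> dist_int ((A n *v x - y) $ i) \<le> r i n" using x by (auto simp: hits_def)
        have "1 \<le> n" using that G1 by (simp add: I_def)
        then have "triangle (r i n) ((A n *v x - y) $ i) = 0" using i r[of n i] by (simp add: triangle_def)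
        then have "f n x = 0" unfolding f_def triangle_box_def by (intro prod_zero) auto
        then show ?thesis by simp
      qed (use f0[of n x] G1 that in \<open>simp add: I_def\<close>)
      then have "(\<Sum>n\<in>I N. f n x) \<le> (\<Sum>n\<in>I N. of_bool (x \<in> hits y r n))" by (rule sum_mono)
      also have "\<dots> = real (card {n \<in> I N. x \<in> hits y r n})" using finI by (simp add: of_bool_def sum.If_cases Int_def)
      also have "\<dots> \<le> real L" unfolding L_def by (intro of_nat_mono card_mono fin) (auto simp: I_def G_def)
      finally show ?thesis .
    qed
    then have "x \<in> B L" using x by (simp add: B_def)
    then show "x \<in> (\<Union>L. B L)" by blast
  qed
  have "(\<Union>L. B L) \<in> null_sets \<mu>"
    using B0 by (intro null_sets_UN) (auto simp: emeasure_eq_measure null_sets_def)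
  then have "space \<mu> - W \<in> null_sets \<mu>" by (rule null_sets_subset) (use sub in auto)
  then have "measure \<mu> (space \<mu> - W) = 0" by (rule measure_eq_0_null_sets)
  then show ?thesis using prob_compl[OF Wm] by (simp add: W_def)
qed

end

theorem theorem1p10:
  fixes \<mu> :: "(real ^ 'n) measure"
    and E :: "(real ^ 'n) set"
    and A :: "nat \<Rightarrow> real ^ 'n ^ 'n"
    and y :: "real ^ 'n"
    and r :: "'n \<Rightarrow> nat \<Rightarrow> real"
    and K s :: real
  assumes "prob_space \<mu>"
    and "sets \<mu> = sets torus_borel"
    and "E \<in> sets torus_borel"
    and "measure_support torus \<mu> \<subseteq> E"
    and "\<And>n. n \<ge> 1 \<Longrightarrow> expanding_integral_matrix (A n)"
    and "K > 1"
    and "\<And>n. n \<ge> 1 \<Longrightarrow> smallest_singular_value (A (Suc n) ** matrix_inv (A n)) \<ge> K"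
    and "s > real CARD('n) + 1"
    and "(\<lambda>t. norm (fourier_coeff \<mu> t)) \<in>
           O[filtercomap infnorm at_top](\<lambda>t. ln (infnorm t) powr (- s))"
    and "y \<in> unit_cube"
    and "\<And>i n. n \<ge> 1 \<Longrightarrow> r i n \<in> {0<..<1/2}"
  shows "(summable (\<lambda>n. \<Prod>i\<in>UNIV. r i (Suc n)) \<longrightarrow>
            measure \<mu> (shrinking_target_set A y (target_box r) \<inter> E) = 0) \<and>
         (\<not> summable (\<lambda>n. \<Prod>i\<in>UNIV. r i (Suc n)) \<longrightarrow>
            measure \<mu> (shrinking_target_set A y (target_box r) \<inter> E) = 1)"
proof -
  interpret prob_space \<mu> by fact
  interpret torus_prob \<mu> by unfold_locales fact
  interpret lacunary_matrices A K
    by unfold_locales (use assms(6,7) expanding_integral_matrix_invertible[OF assms(5)] in auto)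
  have s2: "s > 2"
  proof -
    have "CARD('n) \<ge> 1" by (simp add: Suc_le_eq)
    then show ?thesis using assms(8) by linarith
  qed
  obtain c where c: "c > 0" "\<And>n x. n \<ge> 1 \<Longrightarrow> c * K ^ n * norm x \<le> norm (transpose (A n) *v x)"
    using transpose_growth by blast
  obtain C where C: "C > 0" "\<And>n t. n \<ge> 1 \<Longrightarrow> c / 2 * K ^ n \<le> norm t \<Longrightarrow> norm (fourier_coeff \<mu> t) \<le> C * real n powr (- s)"
    using fourier_decay_powers[OF assms(9), of K "c / 2"] norm_fourier_coeff_le_1 s2 assms(6) c(1) by auto
  interpret lacunary_decay \<mu> A K c C s
    by unfold_locales (use c C s2 in auto)
  have r: "0 < r i n \<and> r i n < 1/2" if "n \<ge> 1" for i n using assms(11)[OF that, of i] by simp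
  define W where "W = shrinking_target_set A y (target_box r)"
  have W: "W \<in> sets \<mu>" unfolding W_def shrinking_target_set_limsup by measurable
  have E: "E \<in> sets \<mu>" using assms by simp
  have "unit_cube - E \<in> null_sets \<mu>"
  proof (rule null_sets_subset[OF null_outside_support])
    show "unit_cube - E \<in> sets \<mu>" using E space_mu sets.compl_sets by metis
  qed (use assms(4) in auto)
  then have "measure \<mu> (W \<inter> E) = measure \<mu> W"
  proof -
    assume n: "unit_cube - E \<in> null_sets \<mu>"
    have "W \<inter> E = W - (unit_cube - E)" using sets.sets_into_space[OF W] space_mu by auto
    then show ?thesis using measure_Diff_null_set[OF W n] by simp
  qed
  then show ?thesis
    using measure_shrinking_targets_convergent[OF r] measure_shrinking_targets_divergent[OF r]
    unfolding W_def by simp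
qed

end
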